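(* Let $M_G$ be a mixed graph with vertex set $V$ and edge set $E$, and let $V_1\subseteq V$ be nonempty. Then \[\det(Q[V_1])=\sum_{M_R}3^{\tau_1}4^{\tau_2},\] where the sum runs over all substructures $M_R$ with vertex set $V_1$ (i.e. over all edge subsets $E_1\subseteq E$ with $|E_1|=|V_1|$) that are substructures of type II, and $\tau_1$, $\tau_2$ are the numbers of components of $M_R$ that are unicyclic graphs belonging to $\Psi_2$ and to $\Psi_3$, respectively. Here $Q[V_1]$ is the principal submatrix of $Q(M_G)$ with rows and columns indexed by $V_1$.
   Context: All graphs are simple, finite and connected. A mixed graph $M_G$ is obtained from a graph $G$ (its underlying graph) by giving directions to some edges. Let $\omega=\frac{1+\sqrt{3}\mathbf{i}}{2}$. $N(M_G)=(n_{ij})$ has $n_{ij}=1$ if $v_i,v_j$ are joined by an undirected edge, $n_{ij}=\omega$ if there is an edge directed $v_i\to v_j$, $n_{ij}=\overline{\omega}$ if directed $v_j\to v_i$, and $0$ otherwise; $Q(M_G)=D(M_G)+N(M_G)$ where $D(M_G)$ is the degree diagonal matrix of $G$. A substructure $M_R$ with vertex subset $V_1\subseteq V$ and edge subset $E_1\subseteq E$ consists of these vertices and edges (an edge of $E_1$ may have one or no endpoint in $V_1$); it is square if $|V_1|=|E_1|$. Its components are the connected pieces of the structure with vertices $V_1$ and edges $E_1$, where each edge of $E_1$ joins those of its endpoints lying in $V_1$ (an edge with no endpoint in $V_1$ is a component on its own). A component is a rootless tree if it is obtained from a tree by deleting one vertex (the root) while keeping the incident edge as an edge with only one endpoint; equivalently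 its edges with both endpoints in $V_1$ form a tree on its vertices and it contains exactly one edge of $E_1$ with exactly one endpoint in $V_1$. A component is a unicyclic graph if all its edges have both endpoints in $V_1$ and it is a connected graph with exactly one cycle. For a mixed cycle, fix a cyclic traversal direction; let $a$ (resp. $b$) be the number of directed edges oriented along (resp. against) the traversal, and $c$ the number of undirected edges. The cycle belongs to $\Psi_1$ if $a-b\equiv 1,2,4$ or $5\pmod 6$ and $c$ is odd; to $\Psi_2$ if $a-b\equiv 1,2,4$ or $5\pmod 6$ and $c$ is even; to $\Psi_3$ if $a-b\equiv 0$ or $3\pmod 6$ and $c$ is odd; to $\Psi_4$ if $a-b\equiv 0$ or $3\pmod 6$ and $c$ is even. A unicyclic mixed graph belongs to the class of its cycle. A square substructure is of type II if each of its components is either a rootless tree or a unicyclic graph not belonging to $\Psi_4$. *)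

theory Defs
  imports Complex_Main "Jordan_Normal_Form.Determinant" "Jordan_Normal_Form.DL_Submatrix"
begin

section \<open>Graphs, cycles, trees\<close>

text \<open>Edges are two-element vertex sets. A graph is given by its vertex set and its edge set.\<close>

definition connected_graph :: "'v set \<Rightarrow> 'v set set \<Rightarrow> bool" where
  "connected_graph W F \<longleftrightarrow>
     W \<noteq> {} \<and> (\<forall>u\<in>W. \<forall>v\<in>W. (u, v) \<in> {(x, y). {x, y} \<in> F}\<^sup>*)"

text \<open>The vertex following position \<open>i\<close> on a cyclic traversal.\<close>

definition cyc_succ :: "'v list \<Rightarrow> nat \<Rightarrow> 'v" where
  "cyc_succ cs i = cs ! (Suc i mod length cs)"

text \<open>A list is a cyclic traversal of a cycle: start vertex and direction are part of the list.
  The cycle itself, as a subgraph, is determined by its set of edges.\<close>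

definition cycle_traversal :: "'v set set \<Rightarrow> 'v list \<Rightarrow> bool" where
  "cycle_traversal F cs \<longleftrightarrow>
     3 \<le> length cs \<and> distinct cs \<and> (\<forall>i<length cs. {cs ! i, cyc_succ cs i} \<in> F)"

definition traversal_edges :: "'v list \<Rightarrow> 'v set set" where
  "traversal_edges cs = {{cs ! i, cyc_succ cs i} | i. i < length cs}"

definition cycles :: "'v set set \<Rightarrow> 'v set set set" where
  "cycles F = {traversal_edges cs | cs. cycle_traversal F cs}"

definition tree_graph :: "'v set \<Rightarrow> 'v set set \<Rightarrow> bool" where
  "tree_graph W F \<longleftrightarrow> connected_graph W F \<and> cycles F = {}"


section \<open>Mixed graphs and their matrices\<close>

text \<open>\<open>(V, E)\<close> is the underlying graph; \<open>(u, v) \<in> A\<close> means that the edge \<open>{u, v}\<close> has been given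
  the direction from \<open>u\<close> to \<open>v\<close>. Edges with no direction in \<open>A\<close> are undirected.\<close>

locale mixed_graph =
  fixes V :: "'v set" and E :: "'v set set" and A :: "('v \<times> 'v) set"
  assumes finite_verts: "finite V"
    and edges_simple: "e \<in> E \<Longrightarrow> e \<subseteq> V \<and> card e = 2"
    and connected: "connected_graph V E"
    and arcs_edges: "(u, v) \<in> A \<Longrightarrow> {u, v} \<in> E"
    and arcs_one_direction: "(u, v) \<in> A \<Longrightarrow> (v, u) \<notin> A"

definition omega :: complex where
  "omega = (1 + complex_of_real (sqrt 3) * \<i>) / 2"

definition N_entry :: "'v set set \<Rightarrow> ('v \<times> 'v) set \<Rightarrow> 'v \<Rightarrow> 'v \<Rightarrow> complex" where
  "N_entry E A u v =
     (if (u, v) \<in> A then omega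
      else if (v, u) \<in> A then cnj omega
      else if {u, v} \<in> E then 1
      else 0)"

definition degree_of :: "'v set set \<Rightarrow> 'v \<Rightarrow> nat" where
  "degree_of E v = card {e \<in> E. v \<in> e}"

text \<open>The list \<open>vs\<close> enumerates the vertices and thereby fixes the indexing of rows and columns.\<close>

definition N_mat :: "'v list \<Rightarrow> 'v set set \<Rightarrow> ('v \<times> 'v) set \<Rightarrow> complex mat" where
  "N_mat vs E A = mat (length vs) (length vs) (\<lambda>(i, j). N_entry E A (vs ! i) (vs ! j))"

definition D_mat :: "'v list \<Rightarrow> 'v set set \<Rightarrow> complex mat" where
  "D_mat vs E = mat_diag (length vs) (\<lambda>i. of_nat (degree_of E (vs ! i)))"

definition Q_mat :: "'v list \<Rightarrow> 'v set set \<Rightarrow> ('v \<times> 'v) set \<Rightarrow> complex mat" where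
  "Q_mat vs E A = D_mat vs E + N_mat vs E A"

definition principal_submatrix :: "'v list \<Rightarrow> 'a mat \<Rightarrow> 'v set \<Rightarrow> 'a mat" where
  "principal_submatrix vs M W =
     (let I = {i. i < length vs \<and> vs ! i \<in> W} in submatrix M I I)"


section \<open>The classes of mixed cycles\<close>

definition num_along :: "('v \<times> 'v) set \<Rightarrow> 'v list \<Rightarrow> nat" where
  "num_along A cs = card {i. i < length cs \<and> (cs ! i, cyc_succ cs i) \<in> A}"

definition num_against :: "('v \<times> 'v) set \<Rightarrow> 'v list \<Rightarrow> nat" where
  "num_against A cs = card {i. i < length cs \<and> (cyc_succ cs i, cs ! i) \<in> A}"

definition num_undirected :: "('v \<times> 'v) set \<Rightarrow> 'v list \<Rightarrow> nat" where
  "num_undirected A cs =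
     card {i. i < length cs \<and> (cs ! i, cyc_succ cs i) \<notin> A \<and> (cyc_succ cs i, cs ! i) \<notin> A}"

definition flow :: "('v \<times> 'v) set \<Rightarrow> 'v list \<Rightarrow> int" where
  "flow A cs = int (num_along A cs) - int (num_against A cs)"

definition Psi1 :: "('v \<times> 'v) set \<Rightarrow> 'v list set" where
  "Psi1 A = {cs. flow A cs mod 6 \<in> {1, 2, 4, 5} \<and> odd (num_undirected A cs)}"

definition Psi2 :: "('v \<times> 'v) set \<Rightarrow> 'v list set" where
  "Psi2 A = {cs. flow A cs mod 6 \<in> {1, 2, 4, 5} \<and> even (num_undirected A cs)}"

definition Psi3 :: "('v \<times> 'v) set \<Rightarrow> 'v list set" where
  "Psi3 A = {cs. flow A cs mod 6 \<in> {0, 3} \<and> odd (num_undirected A cs)}"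

definition Psi4 :: "('v \<times> 'v) set \<Rightarrow> 'v list set" where
  "Psi4 A = {cs. flow A cs mod 6 \<in> {0, 3} \<and> even (num_undirected A cs)}"


section \<open>Substructures\<close>

text \<open>A substructure is a pair of a vertex set and an edge set, where edges need not have their
  endpoints in the vertex set. Its connected pieces are the classes of the equivalence relation
  generated, on the disjoint union of vertices and edges, by incidence. An edge without
  endpoint in \<open>W\<close> is thus a class on its own, as is a vertex without incident edge in \<open>F\<close>.\<close>

definition incidence :: "'v set \<Rightarrow> 'v set set \<Rightarrow> ('v + 'v set) rel" where
  "incidence W F = {(Inl v, Inr e) | v e. v \<in> W \<and> e \<in> F \<and> v \<in> e}"

definition components :: "'v set \<Rightarrow> 'v set set \<Rightarrow> ('v set \<times> 'v set set) set" where
  "components W F =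
     (\<lambda>K. (Inl -` K, Inr -` K)) `
       ((W <+> F) // ((incidence W F \<union> (incidence W F)\<inverse>)\<^sup>*))"

text \<open>The next notions are applied to components. For an edge of a component, the endpoints in
  the vertex set of the component are its endpoints in the vertex set of the whole
  substructure.\<close>

definition rootless_tree :: "'v set \<times> 'v set set \<Rightarrow> bool" where
  "rootless_tree K \<longleftrightarrow>
     (case K of (W, F) \<Rightarrow>
        tree_graph W {e \<in> F. e \<subseteq> W} \<and> (\<exists>!e. e \<in> F \<and> card (e \<inter> W) = 1))"

definition unicyclic :: "'v set \<times> 'v set set \<Rightarrow> bool" where
  "unicyclic K \<longleftrightarrow>
     (case K of (W, F) \<Rightarrow>
        (\<forall>e\<in>F. e \<subseteq> W) \<and> connected_graph W F \<and> (\<exists>!C. C \<in> cycles F))"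

text \<open>The unicyclic graph belongs to the class \<open>P\<close> of its cycle. The existential quantifier only
  chooses a traversal of the unique cycle; changing the start vertex or the direction leaves
  the number of undirected edges and the value of \<open>flow\<close> up to sign unchanged, hence also
  membership in each of the four classes.\<close>

definition unicyclic_in :: "'v list set \<Rightarrow> 'v set \<times> 'v set set \<Rightarrow> bool" where
  "unicyclic_in P K \<longleftrightarrow> unicyclic K \<and> (\<exists>cs. cycle_traversal (snd K) cs \<and> cs \<in> P)"

definition square_substructure :: "'v set \<Rightarrow> 'v set set \<Rightarrow> bool" where
  "square_substructure W F \<longleftrightarrow> card W = card F"

definition type_II :: "('v \<times> 'v) set \<Rightarrow> 'v set \<Rightarrow> 'v set set \<Rightarrow> bool" where
  "type_II A W F \<longleftrightarrow>
     square_substructure W F \<and>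
     (\<forall>K\<in>components W F. rootless_tree K \<or> (unicyclic K \<and> \<not> unicyclic_in (Psi4 A) K))"

definition tau1 :: "('v \<times> 'v) set \<Rightarrow> 'v set \<Rightarrow> 'v set set \<Rightarrow> nat" where
  "tau1 A W F = card {K \<in> components W F. unicyclic_in (Psi2 A) K}"

definition tau2 :: "('v \<times> 'v) set \<Rightarrow> 'v set \<Rightarrow> 'v set set \<Rightarrow> nat" where
  "tau2 A W F = card {K \<in> components W F. unicyclic_in (Psi3 A) K}"

end

theory Submission
  imports Defs "HOL-Combinatorics.Cycles"
begin

text \<open>
  The matrix \<open>Q\<close> factors as \<open>S S\<^sup>*\<close>, where the vertex-edge matrix \<open>S\<close> has entries of modulus 1
  exactly at incidences, so by Cauchy--Binet \<open>det Q[V1]\<close> is the sum of \<open>|det S[V1, E1]|\<^sup>2\<close> over all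
  edge sets \<open>E1\<close> with as many elements as \<open>V1\<close>. These squared moduli are multiplicative over components
  and vanish unless every component has as many edges as vertices, which for a connected piece
  means being a rootless tree or unicyclic. Send each vertex to the first edge on its way to the
  root, respectively to the cycle, and the vertices of the cycle to the next edge along it. In the
  Leibniz expansion relative to this bijection a nonvanishing term never increases the distance to the
  root or cycle, so it comes from the identity or, in the unicyclic case, from the rotation of
  the cycle. The value is 1 for a rootless tree and \<open>|1 - (-1)\<^sup>c \<zeta>\<^sup>m|\<^sup>2\<close> for a unicyclic graph, where
  \<open>\<zeta> = - omega\<close> is a primitive third root of unity and \<open>m\<close> is congruent to \<open>b - a\<close> modulo 3.
\<close>

section \<open>Determinants over finite index sets\<close>

text \<open>The determinant with rows indexed by \<open>W\<close>, where \<open>f\<close> names the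
  column that is paired with each row. No order on the vertices or edges has to be chosen.\<close>

definition ldet :: "('v \<Rightarrow> 'e \<Rightarrow> complex) \<Rightarrow> 'v set \<Rightarrow> ('v \<Rightarrow> 'e) \<Rightarrow> complex" where
  "ldet s W f = (\<Sum>p | p permutes W. of_int (sign p) * (\<Prod>v\<in>W. s (p v) (f v)))"

lemma ldet_cong: "(\<And>v. v \<in> W \<Longrightarrow> f v = g v) \<Longrightarrow> ldet s W f = ldet s W g"
  unfolding ldet_def by (intro sum.cong refl arg_cong2[where f = "(*)"] prod.cong) auto

text \<open>Substituting \<open>p \<circ> q\<close> for \<open>p\<close> and reindexing the product
  along \<open>q\<close> turns each term into a term for \<open>f\<close>, up to
  \<open>sign q\<close>.\<close>

lemma ldet_compose:
  assumes "finite W" "q permutes W"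
  shows "ldet s W (f \<circ> q) = of_int (sign q) * ldet s W f"
proof -
  have "ldet s W (f \<circ> q) =
      (\<Sum>p | p permutes W. of_int (sign (p \<circ> q)) * (\<Prod>v\<in>W. s ((p \<circ> q) v) ((f \<circ> q) v)))"
    unfolding ldet_def by (rule sum_permutations_compose_right[OF assms(2)])
  also have "\<dots> = (\<Sum>p | p permutes W. of_int (sign q) * (of_int (sign p) * (\<Prod>v\<in>W. s (p v) (f v))))"
  proof (intro sum.cong refl)
    fix p assume "p \<in> {p. p permutes W}"
    then have p: "p permutes W" by simp
    have "(\<Prod>v\<in>W. s ((p \<circ> q) v) ((f \<circ> q) v)) = (\<Prod>v\<in>W. s (p v) (f v))"
      using prod.permute[OF assms(2), of "\<lambda>v. s (p v) (f v)"] by (simp add: o_def)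
    moreover have "sign (p \<circ> q) = sign p * sign q"
      using p assms permutation_permutes by (intro sign_compose) blast+
    ultimately show "of_int (sign (p \<circ> q)) * (\<Prod>v\<in>W. s ((p \<circ> q) v) ((f \<circ> q) v))
        = of_int (sign q) * (of_int (sign p) * (\<Prod>v\<in>W. s (p v) (f v)))"
      by (simp add: mult_ac)
  qed
  finally show ?thesis by (simp add: ldet_def sum_distrib_left)
qed

text \<open>Passing to inverse permutations keeps the sign and moves the permutation from the rows
  to the columns.\<close>

lemma ldet_transpose:
  assumes "finite W"
  shows "(\<Sum>p | p permutes W. of_int (sign p) * (\<Prod>v\<in>W. s v (f (p v)))) = ldet s W f"
proof -
  have "ldet s W f =
      (\<Sum>p | p permutes W. of_int (sign (inv_into UNIV p)) * (\<Prod>v\<in>W. s (inv_into UNIV p v) (f v)))"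
    unfolding ldet_def by (rule sum_permutations_inverse)
  also have "\<dots> = (\<Sum>p | p permutes W. of_int (sign p) * (\<Prod>v\<in>W. s v (f (p v))))"
  proof (intro sum.cong refl)
    fix p assume "p \<in> {p. p permutes W}"
    then have p: "p permutes W" by simp
    have "(\<Prod>v\<in>W. s (inv_into UNIV p v) (f v)) = (\<Prod>v\<in>W. s v (f (p v)))"
      using prod.permute[OF p, of "\<lambda>v. s (inv_into UNIV p v) (f v)"] by (simp add: o_def permutes_inverses[OF p])
    moreover have "sign (inv_into UNIV p) = sign p"
      using p assms permutation_permutes by (intro sign_inverse) blast
    ultimately show "of_int (sign (inv_into UNIV p)) * (\<Prod>v\<in>W. s (inv_into UNIV p v) (f v))
        = of_int (sign p) * (\<Prod>v\<in>W. s v (f (p v)))" by simp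
  qed
  finally show ?thesis by simp
qed

text \<open>Swapping two equal columns leaves the matrix unchanged but negates the
  determinant.\<close>

lemma ldet_eq_0_if_not_inj:
  assumes "finite W" "\<not> inj_on f W"
  shows "ldet s W f = 0"
proof -
  obtain u w where uw: "u \<in> W" "w \<in> W" "u \<noteq> w" "f u = f w"
    using assms(2) by (auto simp: inj_on_def)
  have "ldet s W f = ldet s W (f \<circ> transpose u w)"
    by (rule ldet_cong) (use uw in \<open>auto simp: transpose_def\<close>)
  also have "\<dots> = - ldet s W f"
    using ldet_compose[OF assms(1) permutes_swap_id[OF uw(1,2)], of s f] uw(3) by (simp add: sign_swap_id)
  finally show ?thesis by simp
qed

text \<open>The squared modulus does not depend on the chosen bijection between rows and columns.\<close>

definition weight :: "('v \<Rightarrow> 'e \<Rightarrow> complex) \<Rightarrow> 'v set \<Rightarrow> 'e set \<Rightarrow> real" where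
  "weight s W F = (if card W = card F then (cmod (ldet s W (SOME f. bij_betw f W F)))\<^sup>2 else 0)"

text \<open>The permutation is \<open>g\<close> followed by the inverse of \<open>f\<close>,
  extended by the identity outside \<open>W\<close>.\<close>

lemma bij_betw_eq_compose_permutes:
  assumes "bij_betw f W F" "bij_betw g W F"
  obtains q where "q permutes W" "\<And>v. v \<in> W \<Longrightarrow> g v = f (q v)"
proof
  have "bij_betw (inv_into W f \<circ> g) W W"
    using assms bij_betw_trans bij_betw_inv_into by blast
  then show "restrict_id (inv_into W f \<circ> g) W permutes W"
    by (rule permutes_restrict_id)
  show "g v = f (restrict_id (inv_into W f \<circ> g) W v)" if "v \<in> W" for v
    using that assms by (simp add: bij_betw_inv_into_right[OF assms(1)] bij_betwE)
qed

text \<open>Two bijections differ by a permutation of \<open>W\<close>, hence the determinants by a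
  sign, which the modulus forgets. Any convenient bijection may thus replace the one chosen by
  \<open>SOME\<close>.\<close>

lemma weight_eq:
  assumes "finite W" "bij_betw f W F"
  shows "weight s W F = (cmod (ldet s W f))\<^sup>2"
proof -
  define g where "g = (SOME f. bij_betw f W F)"
  have "bij_betw g W F" unfolding g_def using someI[of "\<lambda>f. bij_betw f W F"] assms(2) by blast
  then obtain q where q: "q permutes W" "\<And>v. v \<in> W \<Longrightarrow> g v = f (q v)"
    using bij_betw_eq_compose_permutes[OF assms(2)] by blast
  have "ldet s W g = of_int (sign q) * ldet s W f"
    using ldet_compose[OF assms(1) q(1), of s f] ldet_cong[of W g "f \<circ> q"] q(2) by auto
  then have "cmod (ldet s W g) = cmod (ldet s W f)" by (simp add: norm_mult sign_def)
  then show ?thesis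
    using bij_betw_same_card[OF assms(2)] by (simp add: weight_def g_def)
qed

text \<open>Expanding the product of sums picks an edge \<open>g v\<close> for every row. For fixed
  \<open>g\<close> the sum over \<open>p\<close> is the conjugate of the determinant with columns
  \<open>g\<close>, which vanishes unless \<open>g\<close> is injective; the injective
  \<open>g\<close> are then grouped by their image.\<close>

lemma cauchy_binet:
  assumes fin: "finite W" "finite E"
  shows "(\<Sum>p | p permutes W. of_int (sign p) * (\<Prod>v\<in>W. \<Sum>e\<in>E. s v e * cnj (s (p v) e)))
    = (\<Sum>F | F \<subseteq> E \<and> card F = card W. complex_of_real (weight s W F))"
proof -
  let ?G = "W \<rightarrow>\<^sub>E E"
  let ?h = "\<lambda>g. (\<Prod>v\<in>W. s v (g v)) * cnj (ldet s W g)"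
  let ?G' = "{g \<in> ?G. inj_on g W}"
  let ?T = "{F. F \<subseteq> E \<and> card F = card W}"
  have finG: "finite ?G" using fin by (intro finite_PiE) auto
  have "(\<Sum>p | p permutes W. of_int (sign p) * (\<Prod>v\<in>W. \<Sum>e\<in>E. s v e * cnj (s (p v) e)))
    = (\<Sum>p | p permutes W. \<Sum>g\<in>?G. of_int (sign p) * (\<Prod>v\<in>W. s v (g v) * cnj (s (p v) (g v))))"
    using fin by (simp add: prod_sum_PiE sum_distrib_left)
  also have "\<dots> = (\<Sum>g\<in>?G. \<Sum>p | p permutes W. of_int (sign p) * (\<Prod>v\<in>W. s v (g v) * cnj (s (p v) (g v))))"
    by (rule sum.swap)
  also have "\<dots> = (\<Sum>g\<in>?G. ?h g)"
    by (simp add: ldet_def sum_distrib_left prod.distrib mult_ac)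
  also have "\<dots> = (\<Sum>g\<in>?G'. ?h g)"
    by (rule sum.mono_neutral_right) (use finG fin(1) ldet_eq_0_if_not_inj in auto)
  also have "\<dots> = (\<Sum>F\<in>?T. \<Sum>g\<in>{g \<in> ?G'. g ` W = F}. ?h g)"
    by (rule sum.group[symmetric]) (use finG fin in \<open>auto simp: card_image\<close>)
  also have "\<dots> = (\<Sum>F\<in>?T. complex_of_real (weight s W F))"
  proof (intro sum.cong refl)
    fix F assume "F \<in> ?T"
    then have F: "F \<subseteq> E" "card F = card W" by auto
    have "finite F" using F(1) fin(2) finite_subset by blast
    then obtain f where f: "bij_betw f W F"
      using finite_same_card_bij[OF fin(1)] F(2) by metis
    \<comment> \<open>The injections with image \<open>F\<close> are exactly the maps
      \<open>f \<circ> p\<close>, restricted to \<open>W\<close> because members of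
      \<open>?G\<close> are \<open>undefined\<close> elsewhere.\<close>
    have "(\<Sum>g\<in>{g \<in> ?G'. g ` W = F}. ?h g) = (\<Sum>p | p permutes W. ?h (restrict (f \<circ> p) W))"
    proof (rule sum.reindex_bij_betw[symmetric], rule bij_betw_imageI)
      show "inj_on (\<lambda>p. restrict (f \<circ> p) W) {p. p permutes W}"
      proof (rule inj_onI, rule ext)
        fix p q x assume pq: "p \<in> {p. p permutes W}" "q \<in> {p. p permutes W}"
          and eq: "restrict (f \<circ> p) W = restrict (f \<circ> q) W"
        show "p x = q x"
        proof (cases "x \<in> W")
          case True
          then have "f (p x) = f (q x)" using fun_cong[OF eq, of x] by simp
          then show ?thesis using f pq True by (auto simp: bij_betw_def inj_on_def permutes_in_image)
        next
          case False
          then show ?thesis using pq by (simp add: permutes_not_in)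
        qed
      qed
      show "(\<lambda>p. restrict (f \<circ> p) W) ` {p. p permutes W} = {g \<in> ?G'. g ` W = F}" (is "?L = ?R")
      proof
        show "?L \<subseteq> ?R"
        proof
          fix g assume "g \<in> ?L"
          then obtain p where p: "p permutes W" "g = restrict (f \<circ> p) W" by auto
          have "bij_betw (f \<circ> p) W F" using f permutes_imp_bij[OF p(1)] bij_betw_trans by blast
          then have "bij_betw g W F" unfolding p(2) by (simp add: bij_betw_def)
          then show "g \<in> ?R" using F(1) p(2) by (auto simp: bij_betw_def)
        qed
        show "?R \<subseteq> ?L"
        proof
          fix g assume g: "g \<in> ?R"
          then have "bij_betw g W F" by (auto simp: bij_betw_def)
          then obtain q where q: "q permutes W" "\<And>v. v \<in> W \<Longrightarrow> g v = f (q v)"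
            using bij_betw_eq_compose_permutes[OF f] by blast
          have "g = restrict (f \<circ> q) W"
            using g q(2) by (auto simp: fun_eq_iff PiE_def extensional_def)
          then show "g \<in> ?L" using q(1) by blast
        qed
      qed
    qed
    \<comment> \<open>Permuting columns takes \<open>sign p\<close> out of the conjugated
      determinant, which leaves a transposed Leibniz sum times a constant.\<close>
    also have "\<dots> = (\<Sum>p | p permutes W. (of_int (sign p) * (\<Prod>v\<in>W. s v (f (p v)))) * cnj (ldet s W f))"
    proof (intro sum.cong refl)
      fix p assume "p \<in> {p. p permutes W}"
      then have "ldet s W (restrict (f \<circ> p) W) = of_int (sign p) * ldet s W f"
        using ldet_compose[OF fin(1), of p s f] ldet_cong[of W "restrict (f \<circ> p) W" "f \<circ> p"] by auto
      then show "?h (restrict (f \<circ> p) W) = (of_int (sign p) * (\<Prod>v\<in>W. s v (f (p v)))) * cnj (ldet s W f)"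
        by (simp add: mult_ac)
    qed
    also have "\<dots> = ldet s W f * cnj (ldet s W f)"
      by (simp add: ldet_transpose[OF fin(1)] flip: sum_distrib_right)
    also have "\<dots> = complex_of_real (weight s W F)"
      by (simp only: weight_eq[OF fin(1) f] complex_norm_square)
    finally show "(\<Sum>g\<in>{g \<in> ?G'. g ` W = F}. ?h g) = complex_of_real (weight s W F)" .
  qed
  finally show ?thesis .
qed

text \<open>The hypothesis makes the matrix block triangular. A term survives only if
  \<open>p\<close> maps \<open>W1\<close> onto itself, and such a \<open>p\<close> is uniquely a
  permutation of \<open>W1\<close> composed with one of \<open>W2\<close>.\<close>

lemma ldet_Un:
  assumes fin: "finite W1" "finite W2" and disj: "W1 \<inter> W2 = {}"
    and zero: "\<And>v w. v \<in> W2 \<Longrightarrow> w \<in> W1 \<Longrightarrow> s v (f w) = 0"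
  shows "ldet s (W1 \<union> W2) f = ldet s W1 f * ldet s W2 f"
proof -
  let ?W = "W1 \<union> W2"
  let ?t = "\<lambda>W p. of_int (sign p) * (\<Prod>v\<in>W. s (p v) (f v))"
  have img: "p ` W2 = W2" if "p permutes ?W" "p ` W1 = W1" for p
  proof -
    have "p ` W2 = p ` ?W - p ` W1"
      using disj permutes_inj[OF that(1)] by (auto simp: inj_def)
    then show ?thesis using disj that(2) permutes_image[OF that(1)] by auto
  qed
  have bij: "bij_betw p W1 W1" "bij_betw p W2 W2" if "p permutes ?W" "p ` W1 = W1" for p
    using img[OF that] that permutes_inj_on[OF that(1)] by (auto simp: bij_betw_def)
  have "ldet s ?W f = (\<Sum>p | p permutes ?W \<and> p ` W1 = W1. ?t ?W p)"
    unfolding ldet_def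
  proof (rule sum.mono_neutral_right)
    show "\<forall>p\<in>{p. p permutes ?W} - {p. p permutes ?W \<and> p ` W1 = W1}. ?t ?W p = 0"
    proof
      fix p assume "p \<in> {p. p permutes ?W} - {p. p permutes ?W \<and> p ` W1 = W1}"
      then have p: "p permutes ?W" "p ` W1 \<noteq> W1" by auto
      \<comment> \<open>An injective map of a finite set into itself is onto, so some element must
        leave \<open>W1\<close> and pick a zero entry.\<close>
      have "\<not> p ` W1 \<subseteq> W1"
        using p(2) endo_inj_surj[OF fin(1)] permutes_inj_on[OF p(1)] by blast
      then obtain w where w: "w \<in> W1" "p w \<notin> W1" by blast
      then have "p w \<in> W2" using permutes_in_image[OF p(1)] by blast
      then have "s (p w) (f w) = 0" using zero w(1) by blast
      then have "(\<Prod>v\<in>?W. s (p v) (f v)) = 0" using w(1) fin by (intro prod_zero) auto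
      then show "?t ?W p = 0" by simp
    qed
  qed (use fin finite_permutations in auto)
  also have "\<dots> = (\<Sum>(p, q)\<in>{p. p permutes W1} \<times> {q. q permutes W2}. ?t W1 p * ?t W2 q)"
  \<comment> \<open>\<open>restrict_id\<close> is the identity off its block, so composing the two
    restrictions gives \<open>p\<close> back.\<close>
  proof (rule sum.reindex_bij_witness[where i = "\<lambda>(p, q). p \<circ> q" and j = "\<lambda>p. (restrict_id p W1, restrict_id p W2)"])
    fix p assume "p \<in> {p. p permutes ?W \<and> p ` W1 = W1}"
    then have p: "p permutes ?W" "p ` W1 = W1" by auto
    note r = permutes_restrict_id[OF bij(1)[OF p]] permutes_restrict_id[OF bij(2)[OF p]]
    have in2: "x \<in> W2 \<Longrightarrow> p x \<in> W2" for x using img[OF p] by auto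
    show eq: "(case (restrict_id p W1, restrict_id p W2) of (p, q) \<Rightarrow> p \<circ> q) = p"
    proof
      fix x
      consider "x \<in> W1" "x \<notin> W2" | "x \<in> W2" "x \<notin> W1" | "x \<notin> ?W" using disj by blast
      then show "(case (restrict_id p W1, restrict_id p W2) of (p, q) \<Rightarrow> p \<circ> q) x = p x"
        using in2 disj permutes_not_in[OF p(1)] by cases (auto simp: restrict_id_def)
    qed
    show "(restrict_id p W1, restrict_id p W2) \<in> {p. p permutes W1} \<times> {q. q permutes W2}"
      using r by simp
    have "sign (restrict_id p W1 \<circ> restrict_id p W2) = sign (restrict_id p W1) * sign (restrict_id p W2)"
      using r fin permutation_permutes by (intro sign_compose) blast+
    then have "sign p = sign (restrict_id p W1) * sign (restrict_id p W2)" using eq by simp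
    moreover have "(\<Prod>v\<in>?W. s (p v) (f v))
        = (\<Prod>v\<in>W1. s (restrict_id p W1 v) (f v)) * (\<Prod>v\<in>W2. s (restrict_id p W2 v) (f v))"
      using fin disj by (simp add: prod.union_disjoint)
    ultimately show "(case (restrict_id p W1, restrict_id p W2) of (p, q) \<Rightarrow> ?t W1 p * ?t W2 q) = ?t ?W p"
      by simp
  next
    fix pq assume "pq \<in> {p. p permutes W1} \<times> {q. q permutes W2}"
    then obtain p q where pq: "pq = (p, q)" "p permutes W1" "q permutes W2" by auto
    have 1: "(p \<circ> q) x = p x" if "x \<in> W1" for x
      using that disj permutes_not_in[OF pq(3), of x] by (simp add: disjoint_iff)
    have 2: "(p \<circ> q) x = q x" if "x \<in> W2" for x
      using that disj permutes_not_in[OF pq(2)] permutes_in_image[OF pq(3)] by auto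
    have "restrict_id (p \<circ> q) W1 = p"
      using 1 permutes_not_in[OF pq(2)] by (auto simp: fun_eq_iff restrict_id_def simp del: o_apply)
    moreover have "restrict_id (p \<circ> q) W2 = q"
      using 2 permutes_not_in[OF pq(3)] by (auto simp: fun_eq_iff restrict_id_def simp del: o_apply)
    ultimately show "(restrict_id (case pq of (p, q) \<Rightarrow> p \<circ> q) W1, restrict_id (case pq of (p, q) \<Rightarrow> p \<circ> q) W2) = pq"
      using pq(1) by simp
    have "(p \<circ> q) permutes ?W"
      using permutes_subset[OF pq(2)] permutes_subset[OF pq(3)] permutes_compose by (metis Un_upper1 Un_upper2)
    moreover have "(p \<circ> q) ` W1 = W1"
      using 1 permutes_image[OF pq(2)] by (metis (no_types, lifting) image_cong)
    ultimately show "(case pq of (p, q) \<Rightarrow> p \<circ> q) \<in> {p. p permutes ?W \<and> p ` W1 = W1}"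
      using pq(1) by simp
  qed
  also have "\<dots> = ldet s W1 f * ldet s W2 f"
    by (simp add: ldet_def sum_product sum.cartesian_product)
  finally show ?thesis .
qed

text \<open>If both blocks are square this is the block determinant. If only the union is square, no
  Leibniz term survives. Otherwise both sides vanish by the value 0 given to nonsquare
  pairs.\<close>

lemma weight_Un:
  assumes fin: "finite W1" "finite W2" "finite F1" "finite F2"
    and disj: "W1 \<inter> W2 = {}" "F1 \<inter> F2 = {}"
    and zero: "\<And>v e. v \<in> W1 \<Longrightarrow> e \<in> F2 \<Longrightarrow> s v e = 0" "\<And>v e. v \<in> W2 \<Longrightarrow> e \<in> F1 \<Longrightarrow> s v e = 0"
  shows "weight s (W1 \<union> W2) (F1 \<union> F2) = weight s W1 F1 * weight s W2 F2"
proof -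
  have card: "card (W1 \<union> W2) = card W1 + card W2" "card (F1 \<union> F2) = card F1 + card F2"
    using fin disj card_Un_disjoint by blast+
  consider (sq) "card W1 = card F1" "card W2 = card F2"
    | (bad) "card W1 \<noteq> card F1" "card (W1 \<union> W2) = card (F1 \<union> F2)"
    | (nsq) "card W1 \<noteq> card F1 \<or> card W2 \<noteq> card F2" "card (W1 \<union> W2) \<noteq> card (F1 \<union> F2)"
    using card by linarith
  then show ?thesis
  proof cases
    case sq
    obtain f1 f2 where f12: "bij_betw f1 W1 F1" "bij_betw f2 W2 F2"
      using sq fin finite_same_card_bij by metis
    define f where "f v = (if v \<in> W1 then f1 v else f2 v)" for v
    have f1: "bij_betw f W1 F1"
      using f12(1) by (rule iffD1[OF bij_betw_cong, rotated]) (simp add: f_def)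
    have f2: "bij_betw f W2 F2"
      using f12(2) by (rule iffD1[OF bij_betw_cong, rotated]) (use disj in \<open>auto simp: f_def\<close>)
    have "ldet s (W1 \<union> W2) f = ldet s W1 f * ldet s W2 f"
      using fin disj zero(2) bij_betwE[OF f1] by (intro ldet_Un) auto
    moreover have "bij_betw f (W1 \<union> W2) (F1 \<union> F2)"
      using bij_betw_combine[OF f1 f2 disj(2)] .
    ultimately show ?thesis
      using fin f1 f2 by (simp add: weight_eq norm_mult power_mult_distrib)
  next
    case bad
    obtain f where f: "bij_betw f (W1 \<union> W2) (F1 \<union> F2)"
      using finite_same_card_bij[of "W1 \<union> W2" "F1 \<union> F2"] bad(2) fin by auto
    \<comment> \<open>In a nonvanishing term the columns in \<open>F1\<close> are matched exactly
      with the rows in \<open>W1\<close>, so the two sets would have the same size.\<close>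
    have "(\<Prod>v\<in>W1 \<union> W2. s (p v) (f v)) = 0" if p: "p permutes (W1 \<union> W2)" for p
    proof (rule ccontr)
      assume "(\<Prod>v\<in>W1 \<union> W2. s (p v) (f v)) \<noteq> 0"
      then have nz: "s (p v) (f v) \<noteq> 0" if "v \<in> W1 \<union> W2" for v
        using that fin by auto
      have iff: "f v \<in> F1 \<longleftrightarrow> p v \<in> W1" if v: "v \<in> W1 \<union> W2" for v
      proof -
        have "p v \<in> W1 \<union> W2" "f v \<in> F1 \<union> F2"
          using v permutes_in_image[OF p] bij_betwE[OF f] by blast+
        then show ?thesis using nz[OF v] zero[of "p v" "f v"] disj by blast
      qed
      have "f ` {v \<in> W1 \<union> W2. f v \<in> F1} = F1"
        using f by (auto simp: bij_betw_def image_iff)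
      then have "card {v \<in> W1 \<union> W2. f v \<in> F1} = card F1"
        using card_image[of f "{v \<in> W1 \<union> W2. f v \<in> F1}"] f
        by (metis (no_types, lifting) bij_betw_def inj_on_subset mem_Collect_eq subsetI)
      moreover have "p ` {v \<in> W1 \<union> W2. p v \<in> W1} = W1"
        using permutes_image[OF p] by (auto simp: image_iff)
      then have "card {v \<in> W1 \<union> W2. p v \<in> W1} = card W1"
        using card_image[OF permutes_inj_on[OF p]] by metis
      moreover have "{v \<in> W1 \<union> W2. f v \<in> F1} = {v \<in> W1 \<union> W2. p v \<in> W1}"
        using iff by blast
      ultimately show False using bad(1) by simp
    qed
    then have "ldet s (W1 \<union> W2) f = 0" by (simp add: ldet_def)
    then show ?thesis using fin f bad(1) by (simp add: weight_eq) (simp add: weight_def)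
  next
    case nsq
    then show ?thesis by (auto simp: weight_def)
  qed
qed

lemma weight_empty [simp]: "weight s {} {} = 1"
  using weight_eq[of "{}" undefined "{}" s] by (simp add: bij_betw_def ldet_def)

lemma weight_Union:
  assumes "finite \<K>" "\<And>W F. (W, F) \<in> \<K> \<Longrightarrow> finite W \<and> finite F"
    and "\<And>W F W' F'. (W, F) \<in> \<K> \<Longrightarrow> (W', F') \<in> \<K> \<Longrightarrow> (W, F) \<noteq> (W', F') \<Longrightarrow>
      W \<inter> W' = {} \<and> F \<inter> F' = {} \<and> (\<forall>v\<in>W. \<forall>e\<in>F'. s v e = 0)"
  shows "weight s (\<Union>(fst ` \<K>)) (\<Union>(snd ` \<K>)) = (\<Prod>(W, F)\<in>\<K>. weight s W F)"
  using assms
proof (induction \<K> rule: finite_induct)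
  case (insert K \<K>)
  obtain W F where K: "K = (W, F)" by force
  \<comment> \<open>The hypothesis on pairs is one-sided in rows and columns; reading it in both
    orders yields both zero blocks.\<close>
  have *: "W \<inter> W' = {} \<and> F \<inter> F' = {} \<and> (\<forall>v\<in>W. \<forall>e\<in>F'. s v e = 0) \<and> (\<forall>v\<in>W'. \<forall>e\<in>F. s v e = 0)"
    if "(W', F') \<in> \<K>" for W' F'
  proof -
    have "(W, F) \<noteq> (W', F')" using that insert.hyps K by blast
    then show ?thesis
      using insert.prems(2)[of W F W' F'] insert.prems(2)[of W' F' W F] that K by auto
  qed
  have "weight s (W \<union> \<Union>(fst ` \<K>)) (F \<union> \<Union>(snd ` \<K>))
      = weight s W F * weight s (\<Union>(fst ` \<K>)) (\<Union>(snd ` \<K>))"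
  proof (rule weight_Un)
    show "finite W" "finite F" using insert.prems(1)[of W F] K by auto
    show "finite (\<Union>(fst ` \<K>))" "finite (\<Union>(snd ` \<K>))"
      using insert.prems(1) insert.hyps by fastforce+
    show "W \<inter> \<Union>(fst ` \<K>) = {}" "F \<inter> \<Union>(snd ` \<K>) = {}" using * by fastforce+
    show "s v e = 0" if "v \<in> W" "e \<in> \<Union>(snd ` \<K>)" for v e using * that by force
    show "s v e = 0" if "v \<in> \<Union>(fst ` \<K>)" "e \<in> F" for v e using * that by force
  qed
  also have "weight s (\<Union>(fst ` \<K>)) (\<Union>(snd ` \<K>)) = (\<Prod>(W, F)\<in>\<K>. weight s W F)"
    by (intro insert.IH insert.prems) auto
  finally show ?case using insert.hyps K by simp
qed simp

text \<open>A permutation does not change the sum of \<open>d\<close> over \<open>W\<close>, so none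
  of the inequalities can be strict. This excludes Leibniz terms that move some vertex closer to the
  root or cycle.\<close>

lemma permutes_rank_preserving:
  fixes d :: "'v \<Rightarrow> nat"
  assumes "finite W" "p permutes W" "\<And>v. v \<in> W \<Longrightarrow> d (p v) \<le> d v" "v \<in> W"
  shows "d (p v) = d v"
proof -
  have "(\<Sum>v\<in>W. d (p v)) = (\<Sum>v\<in>W. d v)"
    using sum.permute[OF assms(2), of d] by (simp add: o_def)
  then show ?thesis using sum_mono_inv[of "\<lambda>v. d (p v)" W d v] assms by blast
qed

section \<open>Connected graphs and cycles\<close>

abbreviation adj :: "'v set set \<Rightarrow> 'v rel" where
  "adj F \<equiv> {(x, y). {x, y} \<in> F}"

lemma adj_rtrancl_sym: "(u, v) \<in> (adj F)\<^sup>* \<Longrightarrow> (v, u) \<in> (adj F)\<^sup>*"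
proof -
  have "sym (adj F)" by (auto simp: sym_def insert_commute)
  then show "(u, v) \<in> (adj F)\<^sup>* \<Longrightarrow> (v, u) \<in> (adj F)\<^sup>*" by (metis sym_rtrancl symD)
qed

lemma rtrancl_subset_rtrancl_mono:
  assumes "\<And>x y. (x, y) \<in> R \<Longrightarrow> (x, y) \<in> S\<^sup>*" "(u, v) \<in> R\<^sup>*"
  shows "(u, v) \<in> S\<^sup>*"
  using assms rtrancl_subset_rtrancl by (metis subrelI subsetD)

text \<open>Breadth-first search: \<open>d\<close> is the distance to \<open>R\<close>, and
  \<open>par v\<close> is the second vertex on a shortest walk from \<open>v\<close> to
  \<open>R\<close>.\<close>

lemma parent_function:
  assumes conn: "connected_graph W F" and edges: "\<And>e. e \<in> F \<Longrightarrow> e \<subseteq> W" and R: "R \<subseteq> W" "R \<noteq> {}"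
  obtains d :: "'v \<Rightarrow> nat" and par :: "'v \<Rightarrow> 'v" where
    "\<And>v. v \<in> R \<Longrightarrow> d v = 0"
    "\<And>v. v \<in> W - R \<Longrightarrow> par v \<in> W \<and> {v, par v} \<in> F \<and> d (par v) < d v"
proof -
  define d where "d v = (LEAST n. \<exists>r\<in>R. (v, r) \<in> adj F ^^ n)" for v
  have "\<exists>u. u \<in> W \<and> {v, u} \<in> F \<and> d u < d v" if v: "v \<in> W - R" for v
  proof -
    obtain r where "r \<in> R" using R by blast
    then have "(v, r) \<in> (adj F)\<^sup>*" using conn v R by (auto simp: connected_graph_def)
    then have "\<exists>n. \<exists>r\<in>R. (v, r) \<in> adj F ^^ n" using \<open>r \<in> R\<close> rtrancl_imp_relpow by blast
    then have "\<exists>r\<in>R. (v, r) \<in> adj F ^^ d v" unfolding d_def by (rule LeastI_ex)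
    then obtain r where r: "r \<in> R" "(v, r) \<in> adj F ^^ d v" by blast
    then obtain m where m: "d v = Suc m" using v by (cases "d v") auto
    obtain u where u: "(v, u) \<in> adj F" "(u, r) \<in> adj F ^^ m"
      using relpow_Suc_D2 r(2) unfolding m by metis
    have "d u \<le> m" unfolding d_def using u(2) r(1) by (intro Least_le) blast
    then show ?thesis using u(1) m edges by (intro exI[of _ u]) auto
  qed
  then obtain par where "\<And>v. v \<in> W - R \<Longrightarrow> par v \<in> W \<and> {v, par v} \<in> F \<and> d (par v) < d v"
    by metis
  moreover have "d v = 0" if "v \<in> R" for v
    using that unfolding d_def by (intro Least_eq_0) auto
  ultimately show thesis using that by blast
qed

text \<open>Two vertices with the same parent edge would be parents of each other, against the
  descent of \<open>d\<close>.\<close>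

lemma parent_edge_inj:
  fixes d :: "'v \<Rightarrow> nat"
  assumes "\<And>v. v \<in> U \<Longrightarrow> d (par v) < d v"
  shows "inj_on (\<lambda>v. {v, par v}) U"
proof (rule inj_onI, rule ccontr)
  fix v w assume vw: "v \<in> U" "w \<in> U" "{v, par v} = {w, par w}" "v \<noteq> w"
  then have "par v = w" "par w = v" by (auto simp: doubleton_eq_iff)
  then show False using assms[OF vw(1)] assms[OF vw(2)] by simp
qed

text \<open>The edge set is arbitrary, so this also applies after an edge that is no parent edge has
  been removed.\<close>

lemma parent_reaches_root:
  fixes d :: "'v \<Rightarrow> nat"
  assumes "\<And>v. v \<in> W - R \<Longrightarrow> par v \<in> W \<and> {v, par v} \<in> F \<and> d (par v) < d v" "v \<in> W"
  shows "\<exists>r\<in>R. (v, r) \<in> (adj F)\<^sup>*"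
  using assms(2)
proof (induction "d v" arbitrary: v rule: less_induct)
  case less
  show ?case
  proof (cases "v \<in> R")
    case False
    then have p: "par v \<in> W" "{v, par v} \<in> F" "d (par v) < d v" using assms(1) less.prems by auto
    then obtain r where "r \<in> R" "(par v, r) \<in> (adj F)\<^sup>*" using less.hyps by blast
    moreover have "(v, par v) \<in> adj F" using p(2) by simp
    ultimately show ?thesis by (meson converse_rtrancl_into_rtrancl)
  qed auto
qed

text \<open>A path is prolonged step by step along the walk and cut back whenever the walk returns
  to a vertex on it.\<close>

lemma simple_path:
  assumes "(u, v) \<in> (adj F)\<^sup>*"
  obtains xs where "xs \<noteq> []" "hd xs = u" "last xs = v" "distinct xs" "successively (\<lambda>x y. {x, y} \<in> F) xs"
proof -
  have "\<exists>xs. xs \<noteq> [] \<and> hd xs = u \<and> last xs = v \<and> distinct xs \<and> successively (\<lambda>x y. {x, y} \<in> F) xs"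
    using assms
  proof (induction rule: rtrancl_induct)
    case base
    show ?case by (rule exI[of _ "[u]"]) auto
  next
    case (step y z)
    then obtain xs where xs: "xs \<noteq> []" "hd xs = u" "last xs = y" "distinct xs"
      "successively (\<lambda>x y. {x, y} \<in> F) xs" by blast
    show ?case
    proof (cases "z \<in> set xs")
      case True
      then obtain ys zs where "xs = ys @ z # zs" by (meson split_list)
      then show ?thesis using xs
        by (intro exI[of _ "ys @ [z]"]) (auto simp: successively_append_iff hd_append)
    next
      case False
      then show ?thesis using xs step.hyps(2)
        by (intro exI[of _ "xs @ [z]"]) (auto simp: successively_append_iff)
    qed
  qed
  then show thesis using that by blast
qed

lemma cyc_succ_if: "i < length cs \<Longrightarrow> cyc_succ cs i = (if Suc i = length cs then cs ! 0 else cs ! Suc i)"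
  by (auto simp: cyc_succ_def)

text \<open>A simple path from \<open>u\<close> to \<open>v\<close> is closed up by the new
  edge.\<close>

lemma cycle_through_edge:
  assumes "(u, v) \<in> (adj F)\<^sup>*" "u \<noteq> v" "{u, v} \<notin> F"
  shows "\<exists>cs. cycle_traversal (insert {u, v} F) cs \<and> {u, v} \<in> traversal_edges cs"
proof -
  obtain xs where xs: "xs \<noteq> []" "hd xs = u" "last xs = v" "distinct xs" "successively (\<lambda>x y. {x, y} \<in> F) xs"
    using simple_path[OF assms(1)] by blast
  have path: "{xs ! i, xs ! Suc i} \<in> F" if "Suc i < length xs" for i
    using xs(5) that by (auto simp: successively_conv_nth)
  have ends: "xs ! 0 = u" "xs ! (length xs - 1) = v"
    using xs by (auto simp: hd_conv_nth last_conv_nth)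
  \<comment> \<open>Length 1 would give \<open>u = v\<close>, and length 2 would make
    \<open>{u, v}\<close> an edge of \<open>F\<close>; so the closed path has the three vertices
    that a cycle needs.\<close>
  have "length xs \<noteq> 1" using ends assms(2) by auto
  moreover have "length xs \<noteq> 2" using ends path[of 0] assms(3) by auto
  ultimately have len: "3 \<le> length xs" using xs(1) by (cases "length xs") auto
  have succ: "cyc_succ xs i = (if Suc i = length xs then u else xs ! Suc i)" if "i < length xs" for i
    using cyc_succ_if[OF that] ends by simp
  have close: "{xs ! i, cyc_succ xs i} = {u, v}" if "Suc i = length xs" for i
  proof -
    have "i = length xs - 1" "cyc_succ xs i = u" using that succ[of i] by auto
    then show ?thesis using ends(2) by (simp add: insert_commute)
  qed
  have "{xs ! i, cyc_succ xs i} \<in> insert {u, v} F" if "i < length xs" for i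
  proof (cases "Suc i = length xs")
    case True
    then show ?thesis using close by simp
  next
    case False
    then show ?thesis using that succ[OF that] path by simp
  qed
  moreover have "{u, v} \<in> traversal_edges xs"
  proof -
    have "Suc (length xs - 1) = length xs" using len by simp
    then show ?thesis unfolding traversal_edges_def using close[of "length xs - 1"] by force
  qed
  ultimately show ?thesis using xs(4) len by (auto simp: cycle_traversal_def)
qed

text \<open>Equal edges at two positions would make each position the cyclic successor of the other,
  which happens only in length 2.\<close>

lemma cycle_edge_inj:
  assumes "3 \<le> length cs" "distinct cs"
  shows "inj_on (\<lambda>i. {cs ! i, cyc_succ cs i}) {..<length cs}"
proof (rule inj_onI, rule ccontr)
  fix i j assume ij: "i \<in> {..<length cs}" "j \<in> {..<length cs}"
    "{cs ! i, cyc_succ cs i} = {cs ! j, cyc_succ cs j}" "i \<noteq> j"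
  then have "cs ! i \<noteq> cs ! j" using assms(2) by (simp add: nth_eq_iff_index_eq)
  then have "cyc_succ cs i = cs ! j" "cyc_succ cs j = cs ! i" using ij(3) by (auto simp: doubleton_eq_iff)
  moreover have "Suc i mod length cs < length cs" "Suc j mod length cs < length cs"
    using assms(1) by (auto intro: mod_less_divisor)
  ultimately have "Suc i mod length cs = j" "Suc j mod length cs = i"
    using ij(1,2) assms(2) by (auto simp: cyc_succ_def nth_eq_iff_index_eq)
  then show False using ij(1,2) assms(1) by (auto simp: mod_Suc split: if_splits)
qed

lemma traversal_edges_conv: "traversal_edges cs = (\<lambda>i. {cs ! i, cyc_succ cs i}) ` {..<length cs}"
  by (auto simp: traversal_edges_def)

lemma cycle_traversal_Diff:
  "cycle_traversal (F - {e}) cs \<longleftrightarrow> cycle_traversal F cs \<and> e \<notin> traversal_edges cs"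
  by (auto simp: cycle_traversal_def traversal_edges_conv)

lemma traversal_edges_subset: "cycle_traversal F cs \<Longrightarrow> traversal_edges cs \<subseteq> F"
  by (auto simp: cycle_traversal_def traversal_edges_def)

lemma traversal_edges_nonempty: "cycle_traversal F cs \<Longrightarrow> traversal_edges cs \<noteq> {}"
  by (auto simp: cycle_traversal_def traversal_edges_conv lessThan_empty_iff)

text \<open>The rest of the cycle is a detour around the removed edge.\<close>

lemma connected_remove_cycle_edge:
  assumes conn: "connected_graph W F" and cyc: "cycle_traversal F cs" and e: "e \<in> traversal_edges cs"
  shows "connected_graph W (F - {e})"
proof -
  let ?n = "length cs"
  have n: "3 \<le> ?n" "distinct cs" using cyc by (auto simp: cycle_traversal_def)
  obtain i where i: "i < ?n" "e = {cs ! i, cyc_succ cs i}" using e by (auto simp: traversal_edges_def)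
  \<comment> \<open>The detour starts at the far end of the removed edge; after
    \<open>?n - 1\<close> steps it is back at position \<open>i\<close> without having used the edge
    that starts there.\<close>
  have around: "(cyc_succ cs i, cs ! ((i + Suc m) mod ?n)) \<in> (adj (F - {e}))\<^sup>*" if "m < ?n" for m
    using that
  proof (induction m)
    case (Suc m)
    define j where "j = (i + Suc m) mod ?n"
    have jn: "j < ?n" unfolding j_def using n by (intro mod_less_divisor) auto
    have "j \<noteq> i"
    proof
      assume "j = i"
      moreover have "j = (if i + Suc m < ?n then i + Suc m else i + Suc m - ?n)"
        unfolding j_def using i(1) Suc.prems by (simp add: le_mod_geq)
      ultimately show False using Suc.prems by (simp split: if_splits)
    qed
    then have "{cs ! j, cyc_succ cs j} \<noteq> e"
      using inj_onD[OF cycle_edge_inj[OF n], of j i] jn i by auto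
    moreover have "{cs ! j, cyc_succ cs j} \<in> F" using cyc jn by (auto simp: cycle_traversal_def)
    ultimately have "(cs ! j, cyc_succ cs j) \<in> adj (F - {e})" by simp
    moreover have "cyc_succ cs j = cs ! ((i + Suc (Suc m)) mod ?n)"
      unfolding cyc_succ_def j_def by (simp add: mod_Suc_eq)
    moreover have "(cyc_succ cs i, cs ! j) \<in> (adj (F - {e}))\<^sup>*"
      using Suc unfolding j_def by simp
    ultimately show ?case by (simp add: rtrancl_into_rtrancl)
  qed (simp add: cyc_succ_def)
  have "i + Suc (?n - 1) = i + ?n" using n(1) by linarith
  then have "(i + Suc (?n - 1)) mod ?n = i" using i(1) by simp
  then have ends: "(cyc_succ cs i, cs ! i) \<in> (adj (F - {e}))\<^sup>*"
    using around[of "?n - 1"] n by simp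
  have "(x, y) \<in> (adj (F - {e}))\<^sup>*" if "(x, y) \<in> adj F" for x y
  proof (cases "{x, y} = e")
    case True
    then show ?thesis using i(2) ends adj_rtrancl_sym[OF ends] by (auto simp: doubleton_eq_iff)
  next
    case False
    then show ?thesis using that by auto
  qed
  then show ?thesis using conn rtrancl_subset_rtrancl_mono[of "adj F" "adj (F - {e})"]
    by (simp add: connected_graph_def)
qed

section \<open>Edge counts of connected graphs\<close>

context
  fixes W :: "'v set" and F :: "'v set set"
  assumes fin: "finite W" and edges: "\<And>e. e \<in> F \<Longrightarrow> e \<subseteq> W \<and> card e = 2"
begin

lemma finite_edges: "finite F"
  using fin edges by (meson PowI finite_Pow_iff finite_subset subsetI)

text \<open>The parent edges of the vertices other than a root are distinct.\<close>

lemma connected_card_le: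
  assumes conn: "connected_graph W F"
  shows "card W \<le> card F + 1"
proof -
  obtain r where r: "r \<in> W" using conn by (auto simp: connected_graph_def)
  obtain d :: "'v \<Rightarrow> nat" and par where
    par: "\<And>v. v \<in> W - {r} \<Longrightarrow> par v \<in> W \<and> {v, par v} \<in> F \<and> d (par v) < d v"
    by (rule parent_function[OF conn, of "{r}"]) (use edges r in auto)
  have "card (W - {r}) \<le> card F"
    using par finite_edges parent_edge_inj[of "W - {r}" d par] by (intro card_inj_on_le) auto
  then show ?thesis using r fin by (simp add: card_Diff_singleton)
qed

text \<open>With more edges than that, some edge \<open>e\<close> is no parent edge. The parent
  edges connect its endpoints without it, so \<open>e\<close> closes a cycle.\<close>

lemma connected_acyclic_card:
  assumes conn: "connected_graph W F" and acyc: "cycles F = {}"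
  shows "card W = card F + 1"
proof (rule ccontr)
  assume neq: "card W \<noteq> card F + 1"
  obtain r where r: "r \<in> W" using conn by (auto simp: connected_graph_def)
  obtain d :: "'v \<Rightarrow> nat" and par where
    par: "\<And>v. v \<in> W - {r} \<Longrightarrow> par v \<in> W \<and> {v, par v} \<in> F \<and> d (par v) < d v"
    by (rule parent_function[OF conn, of "{r}"]) (use edges r in auto)
  have "card ((\<lambda>v. {v, par v}) ` (W - {r})) \<le> card W - 1"
    using card_image_le[of "W - {r}" "\<lambda>v. {v, par v}"] fin r by simp
  also have "\<dots> < card F"
  proof -
    have "0 < card W" using r fin by (auto simp: card_gt_0_iff)
    then show ?thesis using connected_card_le[OF conn] neq by linarith
  qed
  finally obtain e where e: "e \<in> F" "e \<notin> (\<lambda>v. {v, par v}) ` (W - {r})"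
    by (meson card_mono finite_Diff finite_imageI fin leD subsetI)
  have reach: "(v, r) \<in> (adj (F - {e}))\<^sup>*" if "v \<in> W" for v
    using parent_reaches_root[of W "{r}" par "F - {e}" d v] par e(2) that by blast
  obtain u v where uv: "e = {u, v}" "u \<noteq> v" using edges[OF e(1)] by (auto simp: card_2_iff)
  have "(u, v) \<in> (adj (F - {e}))\<^sup>*"
    using reach[of u] adj_rtrancl_sym[OF reach[of v]] edges[OF e(1)] uv(1) by (auto intro: rtrancl_trans)
  then obtain cs where "cycle_traversal (insert e (F - {e})) cs"
    using cycle_through_edge[of u v "F - {e}"] uv by auto
  then have "cycle_traversal F cs" using e(1) by (simp add: insert_absorb)
  then show False using acyc by (auto simp: cycles_def)
qed

end

text \<open>Removing an edge of a cycle would leave a connected graph with too few edges.\<close>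

lemma connected_card_acyclic:
  assumes fin: "finite W" and edges: "\<And>e. e \<in> F \<Longrightarrow> e \<subseteq> W \<and> card e = 2"
    and conn: "connected_graph W F" and card: "card W = card F + 1"
  shows "cycles F = {}"
proof (rule ccontr)
  assume "cycles F \<noteq> {}"
  then obtain cs where cs: "cycle_traversal F cs" by (auto simp: cycles_def)
  then obtain e where e: "e \<in> traversal_edges cs" using traversal_edges_nonempty by blast
  have "card W \<le> card (F - {e}) + 1"
    using connected_card_le[OF fin _ connected_remove_cycle_edge[OF conn cs e]] edges by blast
  moreover have "card (F - {e}) < card F"
    using finite_edges[OF fin edges] e traversal_edges_subset[OF cs] by (intro card_Diff1_less) auto
  ultimately show False using card by simp
qed

text \<open>Removing an edge of the only cycle leaves a tree.\<close>

lemma connected_unicyclic_card: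
  assumes fin: "finite W" and edges: "\<And>e. e \<in> F \<Longrightarrow> e \<subseteq> W \<and> card e = 2"
    and conn: "connected_graph W F" and uniq: "\<exists>!C. C \<in> cycles F"
  shows "card W = card F"
proof -
  obtain cs where cs: "cycle_traversal F cs" using uniq by (auto simp: cycles_def)
  then obtain e where e: "e \<in> traversal_edges cs" using traversal_edges_nonempty by blast
  have "cycles (F - {e}) = {}"
  proof (rule ccontr)
    assume "cycles (F - {e}) \<noteq> {}"
    then obtain cs' where cs': "cycle_traversal F cs'" "e \<notin> traversal_edges cs'"
      by (auto simp: cycles_def cycle_traversal_Diff)
    then have "traversal_edges cs = traversal_edges cs'" using uniq cs by (auto simp: cycles_def)
    then show False using cs'(2) e by simp
  qed
  then have "card W = card (F - {e}) + 1"
    using connected_acyclic_card[OF fin _ connected_remove_cycle_edge[OF conn cs e]] edges by blast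
  moreover have "e \<in> F" using e traversal_edges_subset[OF cs] by auto
  ultimately show ?thesis using finite_edges[OF fin edges] by (metis Suc_eq_plus1 card_Suc_Diff1)
qed

text \<open>A cycle exists since the edge count is not that of a tree. Removing any of its edges
  leaves a tree, so every other cycle contains that edge; by symmetry the edge sets agree.\<close>

lemma connected_card_unicyclic:
  assumes fin: "finite W" and edges: "\<And>e. e \<in> F \<Longrightarrow> e \<subseteq> W \<and> card e = 2"
    and conn: "connected_graph W F" and card: "card W = card F"
  shows "\<exists>!C. C \<in> cycles F"
proof -
  have sub: "traversal_edges cs \<subseteq> traversal_edges cs'"
    if cs: "cycle_traversal F cs" and cs': "cycle_traversal F cs'" for cs cs'
  proof (rule ccontr)
    assume "\<not> traversal_edges cs \<subseteq> traversal_edges cs'"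
    then obtain e where e: "e \<in> traversal_edges cs" "e \<notin> traversal_edges cs'" by blast
    have "e \<in> F" using e(1) traversal_edges_subset[OF cs] by auto
    then have "card W = card (F - {e}) + 1"
      using card finite_edges[OF fin edges] by (metis Suc_eq_plus1 card_Suc_Diff1)
    then have "cycles (F - {e}) = {}"
      using connected_card_acyclic[OF fin _ connected_remove_cycle_edge[OF conn cs e(1)]] edges by blast
    moreover have "cycle_traversal (F - {e}) cs'" using cs' e(2) by (simp add: cycle_traversal_Diff)
    ultimately show False by (auto simp: cycles_def)
  qed
  have "cycles F \<noteq> {}" using connected_acyclic_card[OF fin edges conn] card by auto
  then obtain cs where cs: "cycle_traversal F cs" by (auto simp: cycles_def)
  show ?thesis
  proof (rule ex1I)
    show "traversal_edges cs \<in> cycles F" using cs by (auto simp: cycles_def)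
    show "C = traversal_edges cs" if "C \<in> cycles F" for C
      using that cs sub by (auto simp: cycles_def)
  qed
qed

section \<open>Determinants of connected pieces\<close>

text \<open>A cycle through \<open>n\<close> elements is a product of \<open>n - 1\<close>
  transpositions.\<close>

lemma sign_cycle_of_list:
  assumes "distinct cs" "cs \<noteq> []"
  shows "sign (cycle_of_list cs) = (- 1) ^ (length cs - 1)"
  using assms
proof (induction cs rule: cycle_of_list.induct)
  case (1 i j cs)
  have "sign (cycle_of_list (i # j # cs)) = sign (transpose i j) * sign (cycle_of_list (j # cs))"
    by (simp add: sign_compose permutation_swap_id permutation_of_cycle)
  moreover have "sign (cycle_of_list (j # cs)) = (- 1) ^ length cs" using 1 by simp
  moreover have "sign (transpose i j) = - 1" using "1.prems" by (simp add: sign_swap_id)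
  ultimately show ?case by (simp del: cycle_of_list.simps)
qed auto

lemma cycle_of_list_funpow_nth:
  assumes "distinct cs" "i < length cs"
  shows "(cycle_of_list cs ^^ m) (cs ! i) = cs ! ((i + m) mod length cs)"
proof -
  have "(cycle_of_list cs ^^ m) (cs ! i) = map (cycle_of_list cs ^^ m) cs ! i" using assms(2) by simp
  also have "\<dots> = rotate m cs ! i" by (simp only: cyclic_rotation[OF assms(1)])
  also have "\<dots> = cs ! ((i + m) mod length cs)" using nth_rotate[OF assms(2)] by (simp add: add.commute)
  finally show ?thesis .
qed

lemma cycle_of_list_nth:
  "distinct cs \<Longrightarrow> i < length cs \<Longrightarrow> cycle_of_list cs (cs ! i) = cyc_succ cs i"
  using cycle_of_list_funpow_nth[of cs i 1] by (simp add: cyc_succ_def)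

lemma prod_set_distinct: "distinct cs \<Longrightarrow> prod f (set cs) = (\<Prod>i<length cs. f (cs ! i))"
  for f :: "'a \<Rightarrow> 'b::comm_monoid_mult"
  by (rule prod.reindex_bij_betw[symmetric], rule bij_betw_nth) auto

text \<open>A permutation contributing to the determinant moves every cycle vertex to itself or to its
  successor, and one proper move forces all the others.\<close>

lemma permutes_cycle_cases:
  assumes cs: "distinct cs" "2 \<le> length cs" and p: "p permutes (set cs)"
    and mv: "\<And>v. v \<in> set cs \<Longrightarrow> p v = v \<or> p v = cycle_of_list cs v"
  shows "p = id \<or> p = cycle_of_list cs"
proof (cases "\<exists>v\<in>set cs. p v \<noteq> v")
  case False
  then have "p = id" using permutes_not_in[OF p] by (auto simp: fun_eq_iff)
  then show ?thesis by simp
next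
  case True
  let ?\<sigma> = "cycle_of_list cs" and ?n = "length cs"
  obtain i where i: "i < ?n" "p (cs ! i) \<noteq> cs ! i" using True by (auto simp: in_set_conv_nth)
  have \<sigma>: "?\<sigma> permutes set cs" by (rule cycle_permutes)
  have in_cs: "(?\<sigma> ^^ m) (cs ! i) \<in> set cs" for m
  proof -
    have "(i + m) mod ?n < ?n" using i(1) by (intro mod_less_divisor) auto
    then show ?thesis unfolding cycle_of_list_funpow_nth[OF cs(1) i(1)] by (rule nth_mem)
  qed
  have nofix: "?\<sigma> v \<noteq> v" if v: "v \<in> set cs" for v
  proof -
    obtain j where j: "j < ?n" "v = cs ! j" using v by (auto simp: in_set_conv_nth)
    have "Suc j mod ?n = (if Suc j = ?n then 0 else Suc j)" using j(1) by simp
    then have "Suc j mod ?n \<noteq> j" using cs(2) by (cases "Suc j = ?n") auto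
    moreover have "Suc j mod ?n < ?n" using j(1) by (intro mod_less_divisor) linarith
    ultimately have "cs ! (Suc j mod ?n) \<noteq> cs ! j" using nth_eq_iff_index_eq[OF cs(1)] j(1) by blast
    then show ?thesis unfolding j(2) cycle_of_list_nth[OF cs(1) j(1)] cyc_succ_def .
  qed
  have all: "p ((?\<sigma> ^^ m) (cs ! i)) = ?\<sigma> ((?\<sigma> ^^ m) (cs ! i))" for m
  proof (induction m)
    case 0
    then show ?case using mv[of "cs ! i"] i by auto
  next
    case (Suc m)
    let ?x = "(?\<sigma> ^^ m) (cs ! i)"
    \<comment> \<open>The value \<open>?\<sigma> ?x\<close> is already taken by \<open>p\<close> at
      \<open>?x\<close>, so injectivity prevents \<open>?\<sigma> ?x\<close> from being
      fixed.\<close>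
    have "p (?\<sigma> ?x) \<noteq> ?\<sigma> ?x"
      using Suc nofix[OF in_cs[of m]] permutes_inj[OF p] by (metis injD)
    then show ?case using mv[OF in_cs[of "Suc m"]] by auto
  qed
  have "p v = ?\<sigma> v" if v: "v \<in> set cs" for v
  proof -
    obtain j where j: "j < ?n" "v = cs ! j" using v by (auto simp: in_set_conv_nth)
    \<comment> \<open>Going from position \<open>i\<close> to \<open>j\<close> by way of the end of
      the list works whether or not \<open>j < i\<close>.\<close>
    have "i + (?n - i + j) = j + ?n" using i(1) by simp
    then have "(?\<sigma> ^^ (?n - i + j)) (cs ! i) = v"
      using cycle_of_list_funpow_nth[OF cs(1) i(1), of "?n - i + j"] j by simp
    then show ?thesis using all by metis
  qed
  then have "p = ?\<sigma>" using permutes_not_in[OF p] permutes_not_in[OF \<sigma>] by (metis ext)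
  then show ?thesis by simp
qed

section \<open>Weights of rootless trees and unicyclic graphs\<close>

context
  fixes s :: "'v \<Rightarrow> 'v set \<Rightarrow> complex"
  assumes zero: "\<And>v e. v \<notin> e \<Longrightarrow> s v e = 0" and unit: "\<And>v e. v \<in> e \<Longrightarrow> cmod (s v e) = 1"
begin

lemma nonzero_term_incident:
  "finite W \<Longrightarrow> (\<Prod>v\<in>W. s (p v) (f v)) \<noteq> 0 \<Longrightarrow> v \<in> W \<Longrightarrow> p v \<in> f v"
  by (rule ccontr) (use zero prod_zero[of W "\<lambda>v. s (p v) (f v)"] in blast)

text \<open>The vertex at the half edge takes that edge, every other vertex its parent edge. A
  surviving term moves each vertex to itself or its parent, so only the identity remains, and its
  entries have modulus 1.\<close>

lemma rootless_tree_weight: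
  assumes fin: "finite W" and edges: "\<And>e. e \<in> F \<Longrightarrow> card e = 2 \<and> e \<inter> W \<noteq> {}"
    and tree: "rootless_tree (W, F)"
  shows "card W = card F" "weight s W F = 1"
proof -
  define F' where "F' = {e \<in> F. e \<subseteq> W}"
  have conn: "connected_graph W F'" "cycles F' = {}"
    using tree by (auto simp: rootless_tree_def tree_graph_def F'_def)
  obtain h where h: "h \<in> F" "card (h \<inter> W) = 1" "\<And>e. e \<in> F \<Longrightarrow> card (e \<inter> W) = 1 \<Longrightarrow> e = h"
  proof -
    have "\<exists>!e. e \<in> F \<and> card (e \<inter> W) = 1" using tree by (simp add: rootless_tree_def)
    then show ?thesis using that by metis
  qed
  have F': "e \<subseteq> W \<and> card e = 2" if "e \<in> F'" for e using that edges by (auto simp: F'_def)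
  have h_notin: "h \<notin> F'" using h(2) edges[OF h(1)] by (auto simp: F'_def Int_absorb2)
  have F_eq: "F = insert h F'"
  proof (intro equalityI subsetI)
    fix e assume e: "e \<in> F"
    have fe: "finite e" using edges[OF e] by (metis card.infinite zero_neq_numeral)
    \<comment> \<open>Every edge meets \<open>W\<close> in one or two vertices: one makes it
      \<open>h\<close>, two put it inside \<open>W\<close>.\<close>
    have "card (e \<inter> W) \<le> 2" using card_mono[OF fe, of "e \<inter> W"] edges[OF e] by auto
    moreover have "card (e \<inter> W) \<noteq> 0" using fe edges[OF e] by auto
    moreover have "e \<subseteq> W" if "card (e \<inter> W) = 2"
      using card_subset_eq[OF fe, of "e \<inter> W"] that edges[OF e] by auto
    ultimately show "e \<in> insert h F'" using h(3)[OF e] e unfolding F'_def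
      by (metis (mono_tags, lifting) One_nat_def insert_iff le_SucE le_zero_eq mem_Collect_eq numeral_2_eq_2)
  qed (use h(1) F'_def in auto)
  have finF: "finite F'" using finite_edges[OF fin F'] .
  show card: "card W = card F"
    using connected_acyclic_card[OF fin F' conn] F_eq h_notin finF by simp
  obtain r where r: "h \<inter> W = {r}" using h(2) by (auto simp: card_1_singleton_iff)
  then have rW: "r \<in> W" by auto
  obtain d :: "'v \<Rightarrow> nat" and par where
    par: "\<And>v. v \<in> W - {r} \<Longrightarrow> par v \<in> W \<and> {v, par v} \<in> F' \<and> d (par v) < d v"
    by (rule parent_function[OF conn(1), of "{r}"]) (use F' rW in auto)
  define f where "f v = (if v = r then h else {v, par v})" for v
  have "inj_on f W"
  proof -
    have "inj_on f (W - {r})"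
      using parent_edge_inj[of "W - {r}" d par] par by (simp add: f_def inj_on_def)
    moreover have "f r \<notin> f ` (W - {r})" using par h_notin by (auto simp: f_def)
    ultimately show ?thesis using rW by (metis insert_Diff inj_on_insert Diff_idemp)
  qed
  moreover have "f ` W \<subseteq> F" using par F_eq by (auto simp: f_def)
  ultimately have bij: "bij_betw f W F"
    using card finF F_eq by (simp add: bij_betw_def card_image card_subset_eq)
  have only_id: "p = id" if p: "p permutes W" and nz: "(\<Prod>v\<in>W. s (p v) (f v)) \<noteq> 0" for p
  proof -
    \<comment> \<open>The edge \<open>h\<close> has only \<open>r\<close> in \<open>W\<close>, and a
      parent edge offers \<open>v\<close> and its parent as the only rows.\<close>
    have step: "p v = v \<or> d (p v) < d v" if v: "v \<in> W" for v
    proof (cases "v = r")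
      case True
      then show ?thesis using nonzero_term_incident[OF fin nz v] r permutes_in_image[OF p] v
        by (auto simp: f_def)
    next
      case False
      then show ?thesis using nonzero_term_incident[OF fin nz v] par[of v] v by (auto simp: f_def)
    qed
    then have "d (p v) = d v" if "v \<in> W" for v
      using permutes_rank_preserving[OF fin p, of d] that by (metis le_refl less_imp_le)
    then have "p v = v" if "v \<in> W" for v using step that by (metis less_irrefl)
    then show "p = id" using permutes_not_in[OF p] by (auto simp: fun_eq_iff)
  qed
  have "ldet s W f = (\<Sum>p\<in>{id}. of_int (sign p) * (\<Prod>v\<in>W. s (p v) (f v)))"
    unfolding ldet_def using fin only_id
    by (intro sum.mono_neutral_right) (auto simp: finite_permutations permutes_id)
  also have "\<dots> = (\<Prod>v\<in>W. s v (f v))" by simp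
  finally have "cmod (ldet s W f) = (\<Prod>v\<in>W. cmod (s v (f v)))" by (simp add: prod_norm)
  also have "\<dots> = 1" using r by (intro prod.neutral ballI unit) (auto simp: f_def)
  finally show "weight s W F = 1" by (simp add: weight_eq[OF fin bij])
qed

text \<open>With the cycle as the set of roots, the surviving permutations are the identity and the
  rotation of the cycle. Their terms share the factor of the vertices off the cycle, which has
  modulus 1.\<close>

lemma unicyclic_weight:
  assumes fin: "finite W" and edges: "\<And>e. e \<in> F \<Longrightarrow> card e = 2"
    and uni: "unicyclic (W, F)" and cs: "cycle_traversal F cs"
  shows "card W = card F"
    "weight s W F = (cmod (1 - (- 1) ^ length cs * (\<Prod>i<length cs.
        s (cyc_succ cs i) {cs ! i, cyc_succ cs i} * cnj (s (cs ! i) {cs ! i, cyc_succ cs i}))))\<^sup>2"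
proof -
  let ?n = "length cs" and ?\<sigma> = "cycle_of_list cs" and ?e = "\<lambda>i. {cs ! i, cyc_succ cs i}"
  have F: "e \<subseteq> W \<and> card e = 2" if "e \<in> F" for e using that edges uni by (auto simp: unicyclic_def)
  have conn: "connected_graph W F" and uniq: "\<exists>!C. C \<in> cycles F" using uni by (auto simp: unicyclic_def)
  show card: "card W = card F" by (rule connected_unicyclic_card[OF fin F conn uniq])
  have finF: "finite F" using finite_edges[OF fin F] .
  have n: "3 \<le> ?n" "distinct cs" and cF: "\<And>i. i < ?n \<Longrightarrow> ?e i \<in> F"
    using cs by (auto simp: cycle_traversal_def)
  have csW: "set cs \<subseteq> W"
  proof
    fix v assume "v \<in> set cs"
    then obtain i where "i < ?n" "v = cs ! i" by (metis in_set_conv_nth)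
    then show "v \<in> W" using F[OF cF] by auto
  qed
  have \<sigma>: "?\<sigma> permutes set cs" by (rule cycle_permutes)
  have \<sigma>W: "?\<sigma> permutes W" using permutes_subset[OF \<sigma> csW] .
  have \<sigma>nth: "?\<sigma> (cs ! i) = cyc_succ cs i" if "i < ?n" for i using cycle_of_list_nth n(2) that by blast
  obtain d :: "'v \<Rightarrow> nat" and par where
    d0: "\<And>v. v \<in> set cs \<Longrightarrow> d v = 0" and
    par: "\<And>v. v \<in> W - set cs \<Longrightarrow> par v \<in> W \<and> {v, par v} \<in> F \<and> d (par v) < d v"
    by (rule parent_function[OF conn, of "set cs"]) (use F csW n(1) in auto)
  define f where "f v = (if v \<in> set cs then {v, ?\<sigma> v} else {v, par v})" for v
  have f_nth: "f (cs ! i) = ?e i" if "i < ?n" for i using that \<sigma>nth by (simp add: f_def)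
  have "inj_on f W"
  proof -
    have "inj_on f (W - set cs)"
      using parent_edge_inj[of "W - set cs" d par] par by (simp add: f_def inj_on_def)
    moreover have "inj_on f (set cs)"
    proof (rule inj_onI)
      fix v w assume "v \<in> set cs" "w \<in> set cs" "f v = f w"
      then obtain i j where ij: "i < ?n" "j < ?n" "v = cs ! i" "w = cs ! j" by (metis in_set_conv_nth)
      then have "?e i = ?e j" using \<open>f v = f w\<close> by (simp add: f_nth)
      then have "i = j" using cycle_edge_inj[OF n] ij(1,2) by (auto dest: inj_onD)
      then show "v = w" using ij by simp
    qed
    moreover have "f ` set cs \<inter> f ` (W - set cs) = {}"
    proof -
      \<comment> \<open>Edges assigned to cycle vertices stay inside the cycle, whereas a parent
        edge contains a vertex off it.\<close>
      have "f v \<subseteq> set cs" if "v \<in> set cs" for v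
        using that permutes_in_image[OF \<sigma>] by (auto simp: f_def)
      then show ?thesis by (fastforce simp: f_def)
    qed
    ultimately have "inj_on f (set cs \<union> (W - set cs))"
      unfolding inj_on_Un by blast
    then show ?thesis using csW by (simp add: Un_absorb1)
  qed
  moreover have "f ` W \<subseteq> F"
  proof
    fix e assume "e \<in> f ` W"
    then obtain v where v: "v \<in> W" "e = f v" by blast
    show "e \<in> F"
    proof (cases "v \<in> set cs")
      case True
      then obtain i where "i < ?n" "v = cs ! i" by (metis in_set_conv_nth)
      then show ?thesis using v cF by (simp add: f_nth)
    next
      case False
      then show ?thesis using v par by (simp add: f_def)
    qed
  qed
  ultimately have bij: "bij_betw f W F"
    using card finF by (simp add: bij_betw_def card_image card_subset_eq)
  have two: "p = id \<or> p = ?\<sigma>" if p: "p permutes W" and nz: "(\<Prod>v\<in>W. s (p v) (f v)) \<noteq> 0" for p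
  proof -
    note inc = nonzero_term_incident[OF fin nz]
    have cyc: "p v = v \<or> p v = ?\<sigma> v" if v: "v \<in> set cs" for v
      using inc[of v] v csW by (auto simp: f_def)
    have off: "p v = v \<or> d (p v) < d v" if v: "v \<in> W - set cs" for v
      using inc[of v] v par[of v] by (auto simp: f_def)
    \<comment> \<open>The rank is 0 on the whole cycle, so moving along it does not raise the
      rank.\<close>
    have "d (p v) \<le> d v" if "v \<in> W" for v
    proof (cases "v \<in> set cs")
      case True
      then have "p v \<in> set cs" using cyc[OF True] True permutes_in_image[OF \<sigma>] by metis
      then show ?thesis by (simp add: d0)
    next
      case False
      then show ?thesis using off[of v] that by auto
    qed
    then have deq: "d (p v) = d v" if "v \<in> W" for v
      using permutes_rank_preserving[OF fin p, of d] that by blast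
    \<comment> \<open>A move off the cycle would lower the rank, which has just been shown to be
      preserved.\<close>
    have fix_off: "p v = v" if "v \<notin> set cs" for v
      using off[of v] deq[of v] permutes_not_in[OF p, of v] that by (cases "v \<in> W") auto
    have "p permutes set cs"
      using permutes_superset[OF p] fix_off by blast
    then show ?thesis using permutes_cycle_cases[OF n(2) _ _ cyc] n(1) by auto
  qed
  have "?\<sigma> \<noteq> id"
  proof
    assume "?\<sigma> = id"
    then have "cyc_succ cs 0 = cs ! 0" using \<sigma>nth[of 0] n(1) by (metis id_apply less_le_trans zero_less_numeral)
    moreover have len: "0 < ?n" "1 < ?n" using n(1) by linarith+
    moreover have "cyc_succ cs 0 = cs ! 1" using len by (simp add: cyc_succ_def)
    ultimately have "cs ! 1 = cs ! 0" by metis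
    then show False using nth_eq_iff_index_eq[OF n(2) len(2,1)] by simp
  qed
  \<comment> \<open>\<open>T\<close> is the common factor off the cycle; \<open>P\<close> and
    \<open>Q\<close> are the cycle factors of the identity and the rotation.\<close>
  define T where "T = (\<Prod>v\<in>W - set cs. s v (f v))"
  define P where "P = (\<Prod>i<?n. s (cs ! i) (?e i))"
  define Q where "Q = (\<Prod>i<?n. s (cyc_succ cs i) (?e i))"
  have split: "(\<Prod>v\<in>W. g v) = (\<Prod>v\<in>W - set cs. g v) * (\<Prod>v\<in>set cs. g v)" for g :: "'v \<Rightarrow> complex"
    using prod.subset_diff[OF csW fin] by blast
  have PT: "(\<Prod>v\<in>W. s v (f v)) = T * P"
    unfolding split by (simp add: T_def P_def prod_set_distinct[OF n(2)] f_nth)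
  have "(\<Prod>v\<in>W - set cs. s (?\<sigma> v) (f v)) = T"
    unfolding T_def by (intro prod.cong refl) (simp add: permutes_not_in[OF \<sigma>])
  then have QT: "(\<Prod>v\<in>W. s (?\<sigma> v) (f v)) = T * Q"
    unfolding split by (simp add: Q_def prod_set_distinct[OF n(2)] f_nth \<sigma>nth)
  have "ldet s W f = (\<Sum>p\<in>{id, ?\<sigma>}. of_int (sign p) * (\<Prod>v\<in>W. s (p v) (f v)))"
    unfolding ldet_def using fin two \<sigma>W
    by (intro sum.mono_neutral_right) (auto simp: finite_permutations permutes_id)
  also have "\<dots> = T * P + of_int (sign ?\<sigma>) * (T * Q)"
    using \<open>?\<sigma> \<noteq> id\<close> PT QT by simp
  also have "of_int (sign ?\<sigma>) = - ((- 1) ^ ?n :: complex)"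
  proof -
    obtain m where "?n = Suc m" using n(1) by (cases "?n") auto
    moreover have "sign ?\<sigma> = (- 1) ^ (?n - 1)" using n(1) by (intro sign_cycle_of_list[OF n(2)]) auto
    ultimately show ?thesis by simp
  qed
  finally have ldet: "ldet s W f = T * (P - (- 1) ^ ?n * Q)" by (simp add: algebra_simps)
  have "cmod T = 1" unfolding T_def prod_norm[symmetric] by (intro prod.neutral) (auto simp: unit f_def)
  moreover have P1: "cmod P = 1" unfolding P_def prod_norm[symmetric] by (intro prod.neutral) (auto simp: unit)
  \<comment> \<open>Multiplying by \<open>cnj P\<close>, which has modulus 1, normalizes the term of
    the identity to 1.\<close>
  moreover have "cmod (P - (- 1) ^ ?n * Q) = cmod (1 - (- 1) ^ ?n * (Q * cnj P))"
  proof -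
    have "P * cnj P = 1" using P1 complex_norm_square[of P] by simp
    then have "(P - (- 1) ^ ?n * Q) * cnj P = 1 - (- 1) ^ ?n * (Q * cnj P)"
      by (simp add: algebra_simps)
    then show ?thesis using P1 by (metis complex_mod_cnj mult.right_neutral norm_mult)
  qed
  ultimately have "cmod (ldet s W f) = cmod (1 - (- 1) ^ ?n * (Q * cnj P))"
    by (simp add: ldet norm_mult)
  moreover have "Q * cnj P = (\<Prod>i<?n. s (cyc_succ cs i) (?e i) * cnj (s (cs ! i) (?e i)))"
    by (simp add: P_def Q_def prod.distrib)
  ultimately show "weight s W F = (cmod (1 - (- 1) ^ ?n * (\<Prod>i<?n.
      s (cyc_succ cs i) (?e i) * cnj (s (cs ! i) (?e i)))))\<^sup>2"
    by (simp add: weight_eq[OF fin bij])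
qed

end

text \<open>Connectedness needs at least \<open>card W - 1\<close> edges inside \<open>W\<close>, so
  at most one edge sticks out. With none the piece is unicyclic, with one it is a tree plus a half
  edge.\<close>

lemma connected_square_piece:
  assumes fin: "finite W" and edges: "\<And>e. e \<in> F \<Longrightarrow> card e = 2 \<and> e \<inter> W \<noteq> {}"
    and conn: "connected_graph W {e \<in> F. e \<subseteq> W}" and card: "card W = card F"
  shows "rootless_tree (W, F) \<or> unicyclic (W, F)"
proof -
  let ?F' = "{e \<in> F. e \<subseteq> W}" and ?H = "{e \<in> F. \<not> e \<subseteq> W}"
  have F': "e \<subseteq> W \<and> card e = 2" if "e \<in> ?F'" for e using that edges by auto
  have "0 < card W" using fin conn by (auto simp: connected_graph_def card_gt_0_iff)
  then have finF: "finite F" using card by (auto simp: card_gt_0_iff)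
  have "card F = card (?F' \<union> ?H)" by (rule arg_cong[of _ _ card]) auto
  also have "\<dots> = card ?F' + card ?H" using finF by (intro card_Un_disjoint) auto
  finally have sum: "card F = card ?F' + card ?H" .
  \<comment> \<open>Since every edge meets \<open>W\<close>, the edges that are not inside
    \<open>W\<close> are those with exactly one endpoint there.\<close>
  have H_iff: "e \<in> ?H \<longleftrightarrow> e \<in> F \<and> card (e \<inter> W) = 1" for e
  proof (cases "e \<in> F")
    case True
    have fe: "finite e" using edges[OF True] by (metis card.infinite zero_neq_numeral)
    have nz: "card (e \<inter> W) \<noteq> 0" using fe edges[OF True] by auto
    have "card (e \<inter> W) < 2" if "\<not> e \<subseteq> W"
      using psubset_card_mono[OF fe, of "e \<inter> W"] edges[OF True] that by auto
    moreover have "card (e \<inter> W) = 2" if "e \<subseteq> W" using that edges[OF True] by (simp add: Int_absorb2)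
    ultimately show ?thesis using True nz by (cases "e \<subseteq> W") auto
  qed auto
  have "card W \<le> card ?F' + 1" by (rule connected_card_le[OF fin F' conn])
  then consider "card ?H = 0" "card W = card ?F'" | "card ?H = 1" "card W = card ?F' + 1"
    using sum card by linarith
  then show ?thesis
  proof cases
    case 1
    then have "?H = {}" using finF by simp
    then have all: "e \<subseteq> W" if "e \<in> F" for e using that by blast
    then have "?F' = F" by auto
    then show ?thesis
      using connected_card_unicyclic[OF fin F' conn] 1(2) conn all by (simp add: unicyclic_def)
  next
    case 2
    then obtain h where h: "?H = {h}" by (auto simp: card_1_singleton_iff)
    have "\<exists>!e. e \<in> F \<and> card (e \<inter> W) = 1"
      using h H_iff by (metis (no_types, lifting) singletonD singletonI)
    then show ?thesis
      using connected_card_acyclic[OF fin F' conn 2(2)] conn by (simp add: rootless_tree_def tree_graph_def)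
  qed
qed

section \<open>The factorization of the matrix\<close>

text \<open>The factor \<open>omega\<close> sits at the tail of a directed edge. The entry at the
  tail times the conjugate of the entry at the head is then \<open>omega\<close>, and in the
  opposite order \<open>cnj omega\<close>, as in \<open>N_entry\<close>.\<close>

definition inc :: "('v \<times> 'v) set \<Rightarrow> 'v \<Rightarrow> 'v set \<Rightarrow> complex" where
  "inc A v e = (if v \<notin> e then 0 else if \<exists>u. (v, u) \<in> A \<and> e = {v, u} then omega else 1)"

lemma inc_zero: "v \<notin> e \<Longrightarrow> inc A v e = 0"
  by (simp add: inc_def)

lemma omega_simps: "Re omega = 1 / 2" "Im omega = sqrt 3 / 2"
  by (simp_all add: omega_def)

lemma norm_omega: "cmod omega = 1"
proof -
  have "(cmod omega)\<^sup>2 = 1" by (simp add: cmod_power2 omega_simps power_divide)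
  then show ?thesis by (simp add: power2_eq_1_iff norm_ge_zero abs_if) (smt (verit) norm_ge_zero)
qed

lemma inc_unit: "v \<in> e \<Longrightarrow> cmod (inc A v e) = 1"
  by (simp add: inc_def norm_omega)

lemma omega_mult_cnj: "omega * cnj omega = 1"
  using complex_norm_square[of omega] norm_omega by simp

text \<open>The number \<open>- omega\<close> is a primitive third root of unity, so the classes, although stated
  modulo 6, only depend on the flow modulo 3.\<close>

lemma cube_root: "(- omega) ^ 3 = 1" "(- omega) ^ 2 = - cnj omega"
proof -
  have sq: "omega ^ 2 = - cnj omega"
    by (simp add: complex_eq_iff power2_eq_square omega_simps)
  then show "(- omega) ^ 2 = - cnj omega" by simp
  have "(- omega) ^ 3 = - (omega * omega ^ 2)" by (simp add: power3_eq_cube power2_eq_square)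
  then show "(- omega) ^ 3 = 1" by (simp add: sq omega_mult_cnj)
qed

lemma prod_two_cases:
  fixes x y :: "'a::comm_monoid_mult" and n :: nat
  assumes "\<And>i. \<not> (P i \<and> Q i)"
  shows "(\<Prod>i<n. if P i then x else if Q i then y else 1)
    = x ^ card {i. i < n \<and> P i} * y ^ card {i. i < n \<and> Q i}"
proof -
  have 1: "(\<Prod>i<n. if R i then z else 1) = z ^ card {i. i < n \<and> R i}" for R and z :: 'a
  proof -
    have "(\<Prod>i<n. if R i then z else 1) = (\<Prod>i\<in>{i \<in> {..<n}. R i}. z)"
      by (subst prod.inter_filter) simp_all
    then show ?thesis by simp
  qed
  have "(\<Prod>i<n. if P i then x else if Q i then y else 1)
      = (\<Prod>i<n. (if P i then x else 1) * (if Q i then y else 1))"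
    using assms by (intro prod.cong) auto
  then show ?thesis by (simp add: prod.distrib 1)
qed

section \<open>Entries of the product matrix and the values of mixed cycles\<close>

context mixed_graph
begin

lemma finite_E: "finite E"
  using finite_verts edges_simple by (meson PowI finite_Pow_iff finite_subset subsetI)

lemma arcs_neq: "(u, v) \<in> A \<Longrightarrow> u \<noteq> v"
  using arcs_one_direction by blast

lemma inc_pair: "u \<noteq> v \<Longrightarrow> inc A u {u, v} = (if (u, v) \<in> A then omega else 1)"
  by (auto simp: inc_def doubleton_eq_iff)

lemma inc_mult_cnj:
  assumes "u \<noteq> v" "{u, v} \<in> E"
  shows "inc A u {u, v} * cnj (inc A v {u, v}) = N_entry E A u v"
proof -
  have "inc A v {u, v} = (if (v, u) \<in> A then omega else 1)"
    using inc_pair[of v u] assms(1) by (simp add: insert_commute)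
  then show ?thesis
    using assms inc_pair[of u v] arcs_one_direction[of u v] by (auto simp: N_entry_def)
qed

text \<open>On the diagonal each incident edge contributes a squared modulus 1. Off the diagonal
  only the edge \<open>{u, v}\<close> can contribute, as edges have two elements.\<close>

lemma Q_entry_factorization:
  "(\<Sum>e\<in>E. inc A u e * cnj (inc A v e))
    = (if u = v then of_nat (degree_of E u) else 0) + N_entry E A u v"
proof (cases "u = v")
  case True
  have "(\<Sum>e\<in>E. inc A u e * cnj (inc A u e)) = (\<Sum>e\<in>E. if u \<in> e then 1 else 0)"
    by (intro sum.cong refl) (auto simp: inc_def omega_mult_cnj)
  also have "\<dots> = of_nat (degree_of E u)"
    using finite_E by (simp add: degree_of_def sum.inter_filter[symmetric])
  moreover have "N_entry E A u u = 0"
    using arcs_neq edges_simple[of "{u}"] by (auto simp: N_entry_def)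
  ultimately show ?thesis using True by simp
next
  case False
  have zero: "inc A u e * cnj (inc A v e) = 0" if "e \<in> E" "e \<noteq> {u, v}" for e
  proof (rule ccontr)
    assume "inc A u e * cnj (inc A v e) \<noteq> 0"
    then have "{u, v} \<subseteq> e" using inc_zero[of u e A] inc_zero[of v e A] by auto
    moreover have "card e = 2" "finite e"
      using edges_simple[OF that(1)] finite_verts finite_subset by auto
    ultimately have "{u, v} = e" using False by (intro card_subset_eq) auto
    then show False using that(2) by simp
  qed
  show ?thesis
  proof (cases "{u, v} \<in> E")
    case True
    have "(\<Sum>e\<in>E. inc A u e * cnj (inc A v e)) = (\<Sum>e\<in>{{u, v}}. inc A u e * cnj (inc A v e))"
      using True zero finite_E by (intro sum.mono_neutral_right) auto
    then show ?thesis using inc_mult_cnj[OF False True] False by simp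
  next
    case notE: False
    then have "N_entry E A u v = 0" using arcs_edges[of u v] arcs_edges[of v u]
      by (auto simp: N_entry_def insert_commute)
    moreover have "(\<Sum>e\<in>E. inc A u e * cnj (inc A v e)) = 0" using zero notE by (intro sum.neutral) metis
    ultimately show ?thesis using False by simp
  qed
qed

text \<open>The sign \<open>(- 1) ^ (a + b + c)\<close> is shared out: each directed edge turns its
  \<open>omega\<close> or \<open>cnj omega\<close> into the negative, a primitive third root of
  unity, and each undirected edge leaves a factor -1.\<close>

lemma cycle_value:
  assumes cs: "cycle_traversal E cs"
  shows "(cmod (1 - (- 1) ^ length cs * (\<Prod>i<length cs.
        inc A (cyc_succ cs i) {cs ! i, cyc_succ cs i} * cnj (inc A (cs ! i) {cs ! i, cyc_succ cs i}))))\<^sup>2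
    = (if cs \<in> Psi2 A then 3 else if cs \<in> Psi3 A then 4 else if cs \<in> Psi4 A then 0 else 1)"
proof -
  let ?n = "length cs"
  define a b c where abc: "a = num_along A cs" "b = num_against A cs" "c = num_undirected A cs"
  let ?a = "{i. i < ?n \<and> (cs ! i, cyc_succ cs i) \<in> A}"
  let ?b = "{i. i < ?n \<and> (cyc_succ cs i, cs ! i) \<in> A}"
  let ?c = "{i. i < ?n \<and> (cs ! i, cyc_succ cs i) \<notin> A \<and> (cyc_succ cs i, cs ! i) \<notin> A}"
  have "?n = card (?a \<union> (?b \<union> ?c))"
  proof -
    have "?a \<union> (?b \<union> ?c) = {..<?n}" by auto
    then show ?thesis by simp
  qed
  also have "\<dots> = card ?a + (card ?b + card ?c)"
    using arcs_one_direction by (subst card_Un_disjoint, simp, simp, blast, subst card_Un_disjoint) auto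
  finally have n: "?n = a + b + c" by (simp add: abc num_along_def num_against_def num_undirected_def)
  \<comment> \<open>The first factor belongs to the successor, so an edge against the traversal
    yields \<open>omega\<close> and one along it \<open>cnj omega\<close>.\<close>
  have "(\<Prod>i<?n. inc A (cyc_succ cs i) {cs ! i, cyc_succ cs i} * cnj (inc A (cs ! i) {cs ! i, cyc_succ cs i}))
      = (\<Prod>i<?n. if (cyc_succ cs i, cs ! i) \<in> A then omega
          else if (cs ! i, cyc_succ cs i) \<in> A then cnj omega else 1)"
  proof (intro prod.cong refl)
    fix i assume "i \<in> {..<?n}"
    then have e: "{cs ! i, cyc_succ cs i} \<in> E" using cs by (auto simp: cycle_traversal_def)
    then have "cyc_succ cs i \<noteq> cs ! i" using edges_simple[of "{cs ! i, cyc_succ cs i}"] by auto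
    then show "inc A (cyc_succ cs i) {cs ! i, cyc_succ cs i} * cnj (inc A (cs ! i) {cs ! i, cyc_succ cs i})
        = (if (cyc_succ cs i, cs ! i) \<in> A then omega
          else if (cs ! i, cyc_succ cs i) \<in> A then cnj omega else 1)"
      using inc_mult_cnj[of "cyc_succ cs i" "cs ! i"] e by (simp add: insert_commute N_entry_def)
  qed
  also have "\<dots> = omega ^ b * cnj omega ^ a"
    using prod_two_cases[of "\<lambda>i. (cyc_succ cs i, cs ! i) \<in> A" "\<lambda>i. (cs ! i, cyc_succ cs i) \<in> A"]
      arcs_one_direction by (auto simp: abc num_along_def num_against_def)
  finally have "(- 1) ^ ?n * (\<Prod>i<?n. inc A (cyc_succ cs i) {cs ! i, cyc_succ cs i} *
      cnj (inc A (cs ! i) {cs ! i, cyc_succ cs i})) = (- 1) ^ c * ((- omega) ^ b * (- cnj omega) ^ a)"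
    by (simp add: n power_add power_minus[of omega] power_minus[of "cnj omega"])
  \<comment> \<open>Writing \<open>- cnj omega\<close> as a square keeps the exponent natural;
    modulo 3, \<open>2 * a\<close> stands for \<open>- a\<close>, so the exponent is minus the
    flow.\<close>
  also have "(- omega) ^ b * (- cnj omega) ^ a = (- omega) ^ (b + 2 * a)"
    by (simp only: power_add power_mult cube_root(2))
  also have "\<dots> = (- omega) ^ ((b + 2 * a) mod 3)"
  proof -
    have "(- omega) ^ (3 * ((b + 2 * a) div 3) + (b + 2 * a) mod 3) = (- omega) ^ ((b + 2 * a) mod 3)"
      by (simp only: power_add power_mult cube_root(1)) simp
    then show ?thesis by simp
  qed
  finally have val: "(- 1) ^ ?n * (\<Prod>i<?n. inc A (cyc_succ cs i) {cs ! i, cyc_succ cs i} *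
      cnj (inc A (cs ! i) {cs ! i, cyc_succ cs i})) = (- 1) ^ c * (- omega) ^ ((b + 2 * a) mod 3)" .
  have fl: "flow A cs = int a - int b" by (simp add: flow_def abc)
  have sq3: "(sqrt 3 / 2)\<^sup>2 = 3 / 4" by (simp add: power_divide)
  \<comment> \<open>For a primitive third root of unity \<open>z\<close>, \<open>1 - z\<close> is a
    side of the triangle inscribed in the unit circle, and \<open>1 + z = - z^2\<close>.\<close>
  have norms: "(cmod (1 - (- omega)))\<^sup>2 = 3" "(cmod (1 + (- omega)))\<^sup>2 = 1"
    "(cmod (1 - (- omega)\<^sup>2))\<^sup>2 = 3" "(cmod (1 + (- omega)\<^sup>2))\<^sup>2 = 1"
    unfolding cube_root(2) by (simp_all add: cmod_power2 omega_simps sq3) (simp_all add: power2_eq_square)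
  consider "(b + 2 * a) mod 3 = 0" | "(b + 2 * a) mod 3 = 1 \<or> (b + 2 * a) mod 3 = 2" by linarith
  then show ?thesis
  proof cases
    case 1
    then have "flow A cs mod 6 = 0 \<or> flow A cs mod 6 = 3" unfolding fl by presburger
    \<comment> \<open>The root of unity is 1 here, so the number inside the modulus is 0 for even
      \<open>c\<close> and 2 for odd \<open>c\<close>.\<close>
    then show ?thesis unfolding val 1
      by (cases "even c") (auto simp: Psi2_def Psi3_def Psi4_def abc)
  next
    case 2
    then have "flow A cs mod 6 \<in> {1, 2, 4, 5}" unfolding fl insert_iff empty_iff by presburger
    moreover from this have "flow A cs mod 6 \<notin> {0, 3}" by auto
    moreover have "(cmod (1 - (- 1) ^ c * (- omega) ^ ((b + 2 * a) mod 3)))\<^sup>2 = (if even c then 3 else 1)"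
      using 2
    proof
      assume "(b + 2 * a) mod 3 = 1"
      then show ?thesis using norms(1,2) by (simp only: power_one_right) simp
    next
      assume "(b + 2 * a) mod 3 = 2"
      then show ?thesis using norms(3,4) by simp
    qed
    ultimately show ?thesis unfolding val by (simp add: Psi2_def Psi3_def Psi4_def abc)
  qed
qed

end

section \<open>Principal minors as sums over permutations of vertices\<close>

lemma sum_permutes_transport:
  fixes M :: "'b \<Rightarrow> 'b \<Rightarrow> complex"
  assumes b: "bij_betw b I W" and fin: "finite I"
  shows "(\<Sum>p | p permutes I. of_int (sign p) * (\<Prod>i\<in>I. M (b i) (b (p i))))
    = (\<Sum>p | p permutes W. of_int (sign p) * (\<Prod>v\<in>W. M v (p v)))"
\<comment> \<open>\<open>map_permutation\<close> conjugates by the bijection, which preserves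
  signs.\<close>
proof (rule sum.reindex_bij_witness[where j = "map_permutation I b" and i = "map_permutation W (inv_into I b)"])
  have inj: "inj_on b I" using b by (rule bij_betw_imp_inj_on)
  fix p assume "p \<in> {p. p permutes I}"
  then have p: "p permutes I" by simp
  show "map_permutation W (inv_into I b) (map_permutation I b p) = p"
    using map_permutation_compose_inv[OF b p] inv_into_f_f[OF inj] by blast
  show "map_permutation I b p \<in> {p. p permutes W}" using map_permutation_permutes[OF b p] by simp
  have "(\<Prod>v\<in>W. M v (map_permutation I b p v)) = (\<Prod>i\<in>I. M (b i) (map_permutation I b p (b i)))"
    by (rule prod.reindex_bij_betw[OF b, symmetric])
  also have "\<dots> = (\<Prod>i\<in>I. M (b i) (b (p i)))"
    by (intro prod.cong refl) (simp add: map_permutation_apply[OF inj])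
  finally show "of_int (sign (map_permutation I b p)) * (\<Prod>v\<in>W. M v (map_permutation I b p v))
      = of_int (sign p) * (\<Prod>i\<in>I. M (b i) (b (p i)))"
    by (simp add: sign_map_permutation[OF inj p fin])
next
  fix p assume "p \<in> {p. p permutes W}"
  then have p: "p permutes W" by simp
  have b': "bij_betw (inv_into I b) W I" using bij_betw_inv_into[OF b] .
  show "map_permutation I b (map_permutation W (inv_into I b) p) = p"
    using map_permutation_compose_inv[OF b' p] bij_betw_inv_into_right[OF b] by blast
  show "map_permutation W (inv_into I b) p \<in> {p. p permutes I}"
    using map_permutation_permutes[OF b' p] by simp
qed

text \<open>\<open>pick I\<close> lists the selected indices increasingly; followed by
  \<open>vs\<close> it is a bijection from \<open>{0..<n}\<close> to \<open>W\<close>, along which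
  the Leibniz sum is transported.\<close>

lemma det_principal_submatrix:
  fixes M :: "'v \<Rightarrow> 'v \<Rightarrow> complex"
  assumes vs: "distinct vs" "W \<subseteq> set vs"
  shows "det (principal_submatrix vs (mat (length vs) (length vs) (\<lambda>(i, j). M (vs ! i) (vs ! j))) W)
    = (\<Sum>p | p permutes W. of_int (sign p) * (\<Prod>v\<in>W. M v (p v)))"
proof -
  define I where "I = {i. i < length vs \<and> vs ! i \<in> W}"
  define B where "B = mat (length vs) (length vs) (\<lambda>(i, j). M (vs ! i) (vs ! j))"
  define n where "n = card I"
  define b where "b i = vs ! pick I i" for i
  have dim: "{i. i < length vs \<and> i \<in> I} = I" by (auto simp: I_def)
  have pick: "pick I i \<in> I" "pick I i < length vs" if "i < n" for i
    using pick_in_set_le[of i I] that by (auto simp: n_def I_def)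
  have inj: "inj_on (pick I) {0..<n}"
  proof (rule inj_onI)
    fix i j assume ij: "i \<in> {0..<n}" "j \<in> {0..<n}" "pick I i = pick I j"
    \<comment> \<open>The position \<open>i\<close> is recovered from \<open>pick I i\<close> as the
      number of smaller elements of \<open>I\<close>.\<close>
    have "card {a \<in> I. a < pick I i} = i" "card {a \<in> I. a < pick I j} = j"
      using card_pick_le ij(1,2) by (auto simp: n_def)
    then show "i = j" using ij(3) by metis
  qed
  have "finite I" by (simp add: I_def)
  moreover have "card (pick I ` {0..<n}) = card I" using card_image[OF inj] by (simp add: n_def)
  ultimately have "pick I ` {0..<n} = I" using pick(1) by (intro card_subset_eq) auto
  then have "bij_betw (pick I) {0..<n} I" using inj by (simp add: bij_betw_def)
  moreover have "bij_betw ((!) vs) I W"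
  proof (rule bij_betw_imageI)
    show "inj_on ((!) vs) I" using vs(1) by (auto simp: I_def inj_on_def nth_eq_iff_index_eq)
    show "(!) vs ` I = W" using vs(2) by (auto simp: I_def in_set_conv_nth image_iff) (metis in_set_conv_nth subsetD)
  qed
  ultimately have "bij_betw ((!) vs \<circ> pick I) {0..<n} W" by (rule bij_betw_trans)
  then have bij: "bij_betw b {0..<n} W" by (simp add: b_def[abs_def] o_def)
  have sub: "submatrix B I I = mat n n (\<lambda>(i, j). M (b i) (b j))"
  proof (rule eq_matI)
    fix i j assume "i < dim_row (mat n n (\<lambda>(i, j). M (b i) (b j)))" "j < dim_col (mat n n (\<lambda>(i, j). M (b i) (b j)))"
    then have ij: "i < n" "j < n" by auto
    have "submatrix B I I $$ (i, j) = B $$ (pick I i, pick I j)"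
      using ij by (intro submatrix_index) (simp_all add: B_def dim n_def)
    then show "submatrix B I I $$ (i, j) = mat n n (\<lambda>(i, j). M (b i) (b j)) $$ (i, j)"
      using ij pick by (simp add: B_def b_def)
  qed (simp_all add: dim_submatrix B_def dim n_def)
  have "det (principal_submatrix vs B W) = det (mat n n (\<lambda>(i, j). M (b i) (b j)))"
    by (simp add: principal_submatrix_def sub flip: I_def)
  also have "\<dots> = (\<Sum>p | p permutes {0..<n}. of_int (sign p) * (\<Prod>i\<in>{0..<n}. M (b i) (b (p i))))"
    unfolding det_def'[OF mat_carrier]
  proof (intro sum.cong refl arg_cong2[where f = "(*)"] prod.cong)
    fix p i assume "p \<in> {p. p permutes {0..<n}}" "i \<in> {0..<n}"
    then show "mat n n (\<lambda>(i, j). M (b i) (b j)) $$ (i, p i) = M (b i) (b (p i))"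
      using permutes_in_image[of p "{0..<n}" i] by simp
  qed
  also have "\<dots> = (\<Sum>p | p permutes W. of_int (sign p) * (\<Prod>v\<in>W. M v (p v)))"
    by (rule sum_permutes_transport[OF bij]) simp
  finally show ?thesis unfolding B_def .
qed

section \<open>Components of substructures\<close>

abbreviation linked :: "'v set \<Rightarrow> 'v set set \<Rightarrow> ('v + 'v set) rel" where
  "linked W F \<equiv> (incidence W F \<union> (incidence W F)\<inverse>)\<^sup>*"

lemma linked_sym: "(x, y) \<in> linked W F \<Longrightarrow> (y, x) \<in> linked W F"
  by (metis converse_Un converse_converse sup_commute rtrancl_converseI)

lemma linked_in:
  assumes "(x, y) \<in> linked W F" "x \<in> W <+> F"
  shows "y \<in> W <+> F"
  using assms by (induction rule: rtrancl_induct) (auto simp: incidence_def)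

text \<open>Replaces the quotient by the class of one representative \<open>x\<close>, which may be
  a vertex or an edge.\<close>

lemma componentsE:
  assumes "K \<in> components W F"
  obtains x where "x \<in> W <+> F" "fst K = {v. (x, Inl v) \<in> linked W F}" "snd K = {e. (x, Inr e) \<in> linked W F}"
proof -
  obtain c where c: "c \<in> (W <+> F) // linked W F" "K = (Inl -` c, Inr -` c)"
    using assms by (auto simp: components_def)
  obtain x where "x \<in> W <+> F" "c = linked W F `` {x}" using c(1) by (rule quotientE)
  then show thesis using c(2) by (intro that[of x]) auto
qed

lemma componentsI:
  "x \<in> W <+> F \<Longrightarrow> ({v. (x, Inl v) \<in> linked W F}, {e. (x, Inr e) \<in> linked W F}) \<in> components W F"
  by (auto simp: components_def quotient_def vimage_def Image_def image_iff)

lemma component_subset: "(W', F') \<in> components W F \<Longrightarrow> W' \<subseteq> W \<and> F' \<subseteq> F"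
  by (erule componentsE) (auto dest: linked_in)

lemma component_nonempty:
  assumes "(W', F') \<in> components W F"
  shows "W' \<noteq> {} \<or> F' \<noteq> {}"
proof -
  obtain x where x: "W' = {v. (x, Inl v) \<in> linked W F}" "F' = {e. (x, Inr e) \<in> linked W F}"
    using componentsE[OF assms] by auto
  show ?thesis by (cases x) (auto simp: x)
qed

lemma Union_components: "\<Union>(fst ` components W F) = W" "\<Union>(snd ` components W F) = F"
proof -
  have "\<exists>K\<in>components W F. v \<in> fst K" if "v \<in> W" for v
    by (rule bexI[OF _ componentsI[of "Inl v"]]) (use that in auto)
  then show "\<Union>(fst ` components W F) = W" using component_subset[of _ _ W F] by fastforce
  have "\<exists>K\<in>components W F. e \<in> snd K" if "e \<in> F" for e
    by (rule bexI[OF _ componentsI[of "Inr e"]]) (use that in auto)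
  then show "\<Union>(snd ` components W F) = F" using component_subset[of _ _ W F] by fastforce
qed

lemma finite_components: "finite W \<Longrightarrow> finite F \<Longrightarrow> finite (components W F)"
  by (rule finite_subset[of _ "Pow W \<times> Pow F"]) (use component_subset[of _ _ W F] in auto)

text \<open>A shared element, or an incidence between the two, would link the representatives and so
  make the classes equal. The last conjunct provides the zero blocks for
  \<open>weight_Union\<close>.\<close>

lemma components_disjoint:
  assumes K: "(W1, F1) \<in> components W F" "(W2, F2) \<in> components W F" "(W1, F1) \<noteq> (W2, F2)"
  shows "W1 \<inter> W2 = {} \<and> F1 \<inter> F2 = {} \<and> (\<forall>v\<in>W1. \<forall>e\<in>F2. v \<notin> e)"
proof -
  obtain x where x: "W1 = {v. (x, Inl v) \<in> linked W F}" "F1 = {e. (x, Inr e) \<in> linked W F}"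
    using componentsE[OF K(1)] by auto
  obtain y where y: "W2 = {v. (y, Inl v) \<in> linked W F}" "F2 = {e. (y, Inr e) \<in> linked W F}"
    using componentsE[OF K(2)] by auto
  have no: "\<not> ((x, z) \<in> linked W F \<and> (y, z) \<in> linked W F)" for z
  proof
    assume z: "(x, z) \<in> linked W F \<and> (y, z) \<in> linked W F"
    then have xy: "(x, y) \<in> linked W F" "(y, x) \<in> linked W F"
      using linked_sym rtrancl_trans by metis+
    then have "(x, w) \<in> linked W F \<longleftrightarrow> (y, w) \<in> linked W F" for w using rtrancl_trans by metis
    then show False using K(3) x y by simp
  qed
  have "v \<notin> e" if "v \<in> W1" "e \<in> F2" for v e
  proof
    assume "v \<in> e"
    moreover have "v \<in> W" "e \<in> F" using that component_subset K by blast+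
    ultimately have "(Inl v, Inr e) \<in> linked W F" by (auto simp: incidence_def)
    then have "(x, Inr e) \<in> linked W F" using that(1) x(1) by (auto intro: rtrancl_trans)
    then show False using no that(2) y(2) by blast
  qed
  moreover have "W1 \<inter> W2 = {}" "F1 \<inter> F2 = {}" using no x y by blast+
  ultimately show ?thesis by blast
qed

text \<open>A chain of incidences between two vertices of the component alternates between vertices
  and edges, and every edge passed through joins two vertices of \<open>W'\<close> or is left where
  it was entered.\<close>

lemma component_connected:
  assumes K: "(W', F') \<in> components W F" and ne: "W' \<noteq> {}"
    and edges: "\<And>e. e \<in> F \<Longrightarrow> card e = 2"
  shows "connected_graph W' {e \<in> F'. e \<subseteq> W'}" "\<And>e. e \<in> F' \<Longrightarrow> e \<inter> W' \<noteq> {}"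
proof -
  obtain x where x: "W' = {v. (x, Inl v) \<in> linked W F}" "F' = {e. (x, Inr e) \<in> linked W F}"
    using componentsE[OF K] by auto
  let ?R = "adj {e \<in> F'. e \<subseteq> W'}"
  \<comment> \<open>The invariant along such a chain from \<open>u\<close>: a vertex is reachable
    inside the component, an edge has a reachable endpoint.\<close>
  define good where "good u z = (case z of Inl v \<Rightarrow> v \<in> W' \<and> (u, v) \<in> ?R\<^sup>*
      | Inr e \<Rightarrow> e \<in> F' \<and> (\<exists>v\<in>e \<inter> W'. (u, v) \<in> ?R\<^sup>*))" for u z
  have reach: "good u z" if u: "u \<in> W'" and z: "(Inl u, z) \<in> linked W F" for u z
    using z
  proof (induction rule: rtrancl_induct)
    case base
    then show ?case using u by (simp add: good_def)
  next
    case (step y z)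
    have xz: "(x, z) \<in> linked W F"
      using u step.hyps unfolding x(1) by (auto intro: rtrancl_trans rtrancl_into_rtrancl)
    from step.hyps(2) consider
        v e where "y = Inl v" "z = Inr e" "v \<in> W" "e \<in> F" "v \<in> e"
      | v e where "y = Inr e" "z = Inl v" "v \<in> W" "e \<in> F" "v \<in> e"
      by (auto simp: incidence_def)
    then show ?case
    proof cases
      case 1
      then show ?thesis using step.IH xz x(2) by (auto simp: good_def)
    next
      case 2
      then obtain w where w: "w \<in> e" "w \<in> W'" "(u, w) \<in> ?R\<^sup>*" "e \<in> F'"
        using step.IH by (auto simp: good_def)
      have v: "v \<in> W'" using xz 2 x(1) by simp
      show ?thesis
      proof (cases "v = w")
        case True
        then show ?thesis using w 2 by (simp add: good_def)
      next
        case False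
        have "finite e" using edges[OF 2(4)] by (metis card.infinite zero_neq_numeral)
        \<comment> \<open>An edge entered at \<open>w\<close> and left at another vertex
          \<open>v\<close> has no further endpoint, so it lies inside \<open>W'\<close>.\<close>
        then have "{w, v} = e" using False w(1) 2(5) edges[OF 2(4)] by (intro card_subset_eq) auto
        then have "(w, v) \<in> ?R" using w v by auto
        then have "(u, v) \<in> ?R\<^sup>*" using w(3) by (rule rtrancl_into_rtrancl[rotated])
        then show ?thesis using 2 v by (simp add: good_def)
      qed
    qed
  qed
  have link: "(Inl u, z) \<in> linked W F" if "u \<in> W'" "(x, z) \<in> linked W F" for u z
    using that linked_sym[of x "Inl u"] x(1) by (auto intro: rtrancl_trans)
  show "connected_graph W' {e \<in> F'. e \<subseteq> W'}"
    unfolding connected_graph_def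
  proof (intro conjI ne ballI)
    fix u v assume "u \<in> W'" "v \<in> W'"
    then show "(u, v) \<in> ?R\<^sup>*" using reach[of u "Inl v"] link[of u "Inl v"] x(1) by (auto simp: good_def)
  qed
  show "e \<inter> W' \<noteq> {}" if "e \<in> F'" for e
  proof -
    obtain u where "u \<in> W'" using ne by blast
    then show ?thesis using reach[of u "Inr e"] link[of u "Inr e"] x(2) that by (auto simp: good_def)
  qed
qed

section \<open>The determinant formula\<close>

context mixed_graph
begin

text \<open>The weight does not mention a traversal, whereas \<open>cycle_value\<close> computes it
  from any traversal.\<close>

lemma unicyclic_class_weight:
  assumes fin: "finite W" and F: "F \<subseteq> E" and uni: "unicyclic (W, F)"
  shows "weight (inc A) W F
    = (if unicyclic_in (Psi4 A) (W, F) then 0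
       else (if unicyclic_in (Psi2 A) (W, F) then 3 else 1) * (if unicyclic_in (Psi3 A) (W, F) then 4 else 1))"
proof -
  have val: "weight (inc A) W F
      = (if cs \<in> Psi2 A then 3 else if cs \<in> Psi3 A then 4 else if cs \<in> Psi4 A then 0 else 1)"
    if cs: "cycle_traversal F cs" for cs
  proof -
    have "cycle_traversal E cs" using cs F by (auto simp: cycle_traversal_def)
    moreover have "card e = 2" if "e \<in> F" for e using that F edges_simple by blast
    ultimately show ?thesis
      using unicyclic_weight(2)[of "inc A", OF inc_zero inc_unit fin _ uni cs] cycle_value by simp
  qed
  have excl: "Psi2 A \<inter> Psi3 A = {}" "Psi2 A \<inter> Psi4 A = {}" "Psi3 A \<inter> Psi4 A = {}"
    by (auto simp: Psi2_def Psi3_def Psi4_def)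
  obtain cs where cs: "cycle_traversal F cs" using uni by (auto simp: unicyclic_def cycles_def)
  \<comment> \<open>The values 3, 4 and 0 of the three classes differ from each other and from 1, so
    equal weights put all traversals into the same class.\<close>
  have iff: "unicyclic_in P (W, F) \<longleftrightarrow> cs \<in> P" if P: "P \<in> {Psi2 A, Psi3 A, Psi4 A}" for P
  proof
    assume "unicyclic_in P (W, F)"
    then obtain cs' where "cycle_traversal F cs'" "cs' \<in> P" by (auto simp: unicyclic_in_def)
    then show "cs \<in> P" using val[of cs'] val[OF cs] P excl by (auto split: if_splits)
  next
    assume "cs \<in> P"
    then show "unicyclic_in P (W, F)" using uni cs by (auto simp: unicyclic_in_def)
  qed
  show ?thesis using val[OF cs] excl by (auto simp: iff)
qed

text \<open>A component of neither kind has different numbers of vertices and edges, hence weight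
  0.\<close>

lemma component_weight:
  assumes fin: "finite W" and F: "F \<subseteq> E" and K: "(W', F') \<in> components W F"
  shows "weight (inc A) W' F'
    = (if rootless_tree (W', F') \<or> (unicyclic (W', F') \<and> \<not> unicyclic_in (Psi4 A) (W', F'))
       then (if unicyclic_in (Psi2 A) (W', F') then 3 else 1) * (if unicyclic_in (Psi3 A) (W', F') then 4 else 1)
       else 0)"
proof -
  have sub: "W' \<subseteq> W" "F' \<subseteq> F" using component_subset[OF K] by auto
  have finK: "finite W'" "finite F'"
    using sub fin F finite_E by (meson finite_subset)+
  have edges: "card e = 2" if "e \<in> F" for e using that F edges_simple by blast
  have touch: "card e = 2 \<and> e \<inter> W' \<noteq> {}" if "e \<in> F'" "W' \<noteq> {}" for e
    using component_connected(2)[OF K that(2) edges that(1)] edges sub that(1) by blast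
  have ne: "W' \<noteq> {}" if "rootless_tree (W', F') \<or> unicyclic (W', F')"
    using that by (auto simp: rootless_tree_def unicyclic_def tree_graph_def connected_graph_def)
  consider (tree) "rootless_tree (W', F')" | (uni) "unicyclic (W', F')"
    | (none) "\<not> rootless_tree (W', F')" "\<not> unicyclic (W', F')" by blast
  then show ?thesis
  proof cases
    case tree
    \<comment> \<open>The half edge has an endpoint outside \<open>W'\<close>, while a unicyclic
      graph contains both endpoints of its edges. Hence both class factors are 1.\<close>
    then have "\<not> unicyclic (W', F')"
      using ne touch by (auto simp: rootless_tree_def unicyclic_def Int_absorb2)
    then have "\<not> unicyclic_in P (W', F')" for P by (simp add: unicyclic_in_def)
    then show ?thesis
      using rootless_tree_weight(2)[of "inc A", OF inc_zero inc_unit finK(1) touch tree] tree ne by simp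
  next
    case uni
    then have "\<not> rootless_tree (W', F')"
      using ne touch by (auto simp: rootless_tree_def unicyclic_def Int_absorb2)
    then show ?thesis
      using unicyclic_class_weight[OF finK(1) _ uni] sub F uni by auto
  next
    case none
    have "card W' \<noteq> card F'"
    proof (cases "W' = {}")
      \<comment> \<open>A component without vertices still has an edge, so it is not square.\<close>
      case True
      then show ?thesis using component_nonempty[OF K] finK by auto
    next
      case False
      then show ?thesis
        using connected_square_piece[OF finK(1) touch component_connected(1)[OF K False edges]] none by blast
    qed
    then show ?thesis using none by (simp add: weight_def)
  qed
qed

text \<open>The weight is the product over the components; counting the factors 3 and 4 gives the
  exponents, and one component of a wrong kind makes the product 0.\<close>

lemma substructure_weight:
  assumes fin: "finite W" and F: "F \<subseteq> E" "card F = card W"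
  shows "weight (inc A) W F = (if type_II A W F then 3 ^ tau1 A W F * 4 ^ tau2 A W F else 0)"
proof -
  let ?C = "components W F"
  let ?good = "\<lambda>K. rootless_tree K \<or> (unicyclic K \<and> \<not> unicyclic_in (Psi4 A) K)"
  have finF: "finite F" using F finite_E finite_subset by blast
  have finC: "finite ?C" by (rule finite_components[OF fin finF])
  have "weight (inc A) W F = weight (inc A) (\<Union>(fst ` ?C)) (\<Union>(snd ` ?C))"
    by (simp add: Union_components)
  also have "\<dots> = (\<Prod>(W', F')\<in>?C. weight (inc A) W' F')"
  proof (rule weight_Union[OF finC])
    show "finite W' \<and> finite F'" if "(W', F') \<in> ?C" for W' F'
      using component_subset[OF that] fin finF by (auto intro: finite_subset)
    show "W1 \<inter> W2 = {} \<and> F1 \<inter> F2 = {} \<and> (\<forall>v\<in>W1. \<forall>e\<in>F2. inc A v e = 0)"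
      if "(W1, F1) \<in> ?C" "(W2, F2) \<in> ?C" "(W1, F1) \<noteq> (W2, F2)" for W1 F1 W2 F2
      using components_disjoint[OF that] by (simp add: inc_zero)
  qed
  also have "\<dots> = (\<Prod>K\<in>?C. if ?good K then
      (if unicyclic_in (Psi2 A) K then 3 else 1) * (if unicyclic_in (Psi3 A) K then 4 else 1) else 0)"
  proof (intro prod.cong refl)
    fix K assume "K \<in> ?C"
    moreover obtain W' F' where "K = (W', F')" by force
    ultimately show "(case K of (W', F') \<Rightarrow> weight (inc A) W' F') = (if ?good K then
        (if unicyclic_in (Psi2 A) K then 3 else 1) * (if unicyclic_in (Psi3 A) K then 4 else 1) else 0)"
      using component_weight[OF fin F(1), of W' F'] by simp
  qed
  also have "\<dots> = (if type_II A W F then 3 ^ tau1 A W F * 4 ^ tau2 A W F else 0)"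
  proof (cases "\<forall>K\<in>?C. ?good K")
    case True
    then have "(\<Prod>K\<in>?C. if ?good K then
        (if unicyclic_in (Psi2 A) K then 3 else 1) * (if unicyclic_in (Psi3 A) K then 4 else 1) else 0)
      = (\<Prod>K\<in>?C. if unicyclic_in (Psi2 A) K then 3 else 1) * (\<Prod>K\<in>?C. if unicyclic_in (Psi3 A) K then 4 else 1 :: real)"
      unfolding prod.distrib[symmetric] by (intro prod.cong refl) simp
    also have "\<dots> = 3 ^ tau1 A W F * 4 ^ tau2 A W F"
      using finC by (simp add: tau1_def tau2_def flip: prod.inter_filter)
    finally show ?thesis using True F(2) by (simp add: type_II_def square_substructure_def)
  next
    case False
    then have "\<not> type_II A W F" by (auto simp: type_II_def)
    moreover obtain K where "K \<in> ?C" "\<not> ?good K" using False by blast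
    ultimately show ?thesis using finC by (simp, blast)
  qed
  finally show ?thesis .
qed

end

theorem theorem2p8:
  fixes V V1 :: "'v set" and E :: "'v set set" and A :: "('v \<times> 'v) set" and vs :: "'v list"
  assumes "mixed_graph V E A"
    and "distinct vs" and "set vs = V"
    and "V1 \<subseteq> V" and "V1 \<noteq> {}"
  shows "det (principal_submatrix vs (Q_mat vs E A) V1) =
    (\<Sum>E1 | E1 \<subseteq> E \<and> type_II A V1 E1. 3 ^ tau1 A V1 E1 * 4 ^ tau2 A V1 E1)"
proof -
  interpret mixed_graph V E A by fact
  let ?s = "inc A"
  have fin: "finite V1" using assms(4) finite_verts finite_subset by blast
  \<comment> \<open>The matrix is rewritten as a vertex-edge matrix times its conjugate
    transpose.\<close>
  have "Q_mat vs E A = mat (length vs) (length vs) (\<lambda>(i, j). \<Sum>e\<in>E. ?s (vs ! i) e * cnj (?s (vs ! j) e))"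
  proof (rule eq_matI)
    fix i j
    assume "i < dim_row (mat (length vs) (length vs) (\<lambda>(i, j). \<Sum>e\<in>E. ?s (vs ! i) e * cnj (?s (vs ! j) e)))"
      "j < dim_col (mat (length vs) (length vs) (\<lambda>(i, j). \<Sum>e\<in>E. ?s (vs ! i) e * cnj (?s (vs ! j) e)))"
    then have ij: "i < length vs" "j < length vs" by auto
    then show "Q_mat vs E A $$ (i, j)
        = mat (length vs) (length vs) (\<lambda>(i, j). \<Sum>e\<in>E. ?s (vs ! i) e * cnj (?s (vs ! j) e)) $$ (i, j)"
      using assms(2)
      by (simp add: Q_mat_def D_mat_def N_mat_def mat_diag_def Q_entry_factorization nth_eq_iff_index_eq)
  qed (simp_all add: Q_mat_def D_mat_def N_mat_def)
  then have "det (principal_submatrix vs (Q_mat vs E A) V1)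
      = (\<Sum>p | p permutes V1. of_int (sign p) * (\<Prod>v\<in>V1. \<Sum>e\<in>E. ?s v e * cnj (?s (p v) e)))"
    using det_principal_submatrix[of vs V1 "\<lambda>u v. \<Sum>e\<in>E. ?s u e * cnj (?s v e)"] assms by simp
  also have "\<dots> = (\<Sum>E1 | E1 \<subseteq> E \<and> card E1 = card V1. complex_of_real (weight ?s V1 E1))"
    by (rule cauchy_binet[OF fin finite_E])
  also have "\<dots> = (\<Sum>E1 | E1 \<subseteq> E \<and> card E1 = card V1.
      if type_II A V1 E1 then 3 ^ tau1 A V1 E1 * 4 ^ tau2 A V1 E1 else 0)"
    by (intro sum.cong refl) (simp add: substructure_weight[OF fin])
  \<comment> \<open>\<open>type_II\<close> entails squareness, so the two index sets differ only by
    zero terms.\<close>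
  also have "\<dots> = (\<Sum>E1 | E1 \<subseteq> E \<and> type_II A V1 E1. 3 ^ tau1 A V1 E1 * 4 ^ tau2 A V1 E1)"
    using finite_E by (intro sum.mono_neutral_cong_right) (auto simp: type_II_def square_substructure_def)
  finally show ?thesis .
qed

end
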